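(* Let $m$ be an integer with $m\equiv 1\pmod{3}$. (i) For every positive integer $n$, $$\nu_3\bigg(\frac{1}{n}\sum_{k=0}^{n-1}\frac{1}{m^k}\binom{2k}{k}\bigg)\geq \min\{\nu_3(n),\ \nu_3(m-1)-1\},$$ and for every integer $a\geq \nu_3(m-1)$, $$\frac{1}{3^a}\sum_{k=0}^{3^a-1}\frac{1}{m^k}\binom{2k}{k}\equiv \frac{m-1}{3}\pmod{3^{\nu_3(m-1)}}.$$ (ii) For every positive integer $n$, $$\nu_3\bigg(\frac{1}{n}\sum_{k=0}^{n-1}\frac{(-1)^k}{m^k}\binom{n-1}{k}\binom{2k}{k}\bigg)\geq \min\{\nu_3(n),\ \nu_3(m-1)\}-1,$$ and for every integer $a>\nu_3(m-1)$, $$\frac{1}{3^a}\sum_{k=0}^{3^a-1}\frac{(-1)^k}{m^k}\binom{3^a-1}{k}\binom{2k}{k}\equiv -\frac{m-1}{3}\pmod{3^{\nu_3(m-1)}}.$$ (iii) For every integer $a\geq 2$, $$\frac{1}{3^a}\sum_{k=0}^{3^a-1}(-1)^k\binom{3^a-1}{k}\binom{2k}{k}\equiv -3^{a-1}\pmod{3^a}.$$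
   Context: For a prime $p$ and a nonzero rational number $r$, $\nu_p(r)$ denotes the $p$-adic order of $r$ (the exponent of $p$ in $r$), with the convention $\nu_p(0)=+\infty$. For rational numbers $x,y$ and an integer $e$, $x\equiv y\pmod{3^e}$ means $\nu_3(x-y)\geq e$; a congruence modulo $3^{+\infty}$ means equality. (In particular, when $m=1$ the conditions "$a\geq\nu_3(m-1)$" and "$a>\nu_3(m-1)$" are satisfied by no integer $a$.) *)

theory Defs
  imports
    Complex_Main
    "HOL-Library.Extended"
    "HOL-Number_Theory.Cong"
    "HOL-Computational_Algebra.Primes"
begin

text \<open>
  The \<open>p\<close>-adic order of a rational number, with value \<open>\<infinity>\<close> at \<open>0\<close>. It is meant for
  prime \<open>p\<close>. \<^const>\<open>quotient_of\<close> returns the fraction in lowest terms, with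
  positive denominator.
\<close>

definition padic_order :: "nat \<Rightarrow> rat \<Rightarrow> int extended" where
  "padic_order p r =
     (if r = 0 then \<infinity>
      else Fin (int (multiplicity (int p) (fst (quotient_of r)))
                - int (multiplicity (int p) (snd (quotient_of r)))))"

text \<open>
  Congruence of rationals modulo \<open>p\<close> to the power \<open>e\<close>. The exponent may be \<open>\<infinity>\<close>,
  in which case the congruence is equality.
\<close>

definition padic_cong :: "nat \<Rightarrow> int extended \<Rightarrow> rat \<Rightarrow> rat \<Rightarrow> bool" where
  "padic_cong p e x y \<longleftrightarrow> padic_order p (x - y) \<ge> e"

lemma padic_cong_infinity: "padic_cong p \<infinity> x y \<longleftrightarrow> x = y"
  by (simp add: padic_cong_def padic_order_def)

end

theory Submission
  imports Defs "HOL-Computational_Algebra.Formal_Power_Series"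
begin

text \<open>
  Write \<open>w = (m - 1) / 3\<close> and \<open>N = n - 1\<close>. Expanding the sum in (i) around \<open>m = 4\<close> turns it, up
  to the factor \<open>n * binomial (2 * n) n\<close> and a unit, into
  \<open>\<Sum>j\<le>N. binomial N j * (4 - m) ^ j * m ^ (N - j) / (2 * j + 1)\<close>. As \<open>4 - m = 3 * (1 - w)\<close> and
  \<open>3 ^ j / (2 * j + 1)\<close> is divisible by 3 for \<open>j \<ge> 2\<close>, only \<open>j = 1\<close> contributes to the dependence
  on \<open>m\<close>, and this reduces (i) to \<open>m = 1\<close>. There \<open>binomial N j\<close> is 3-adically close to \<open>(-1) ^ j\<close>,
  and the sum becomes a truncation of \<open>\<Sum>j. (-3) ^ j / (2 * j + 1)\<close>, which vanishes 3-adically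
  because it is the logarithm of a cube root of unity divided by \<open>2 * sqrt (-3)\<close>.

  Summation by parts carries the dependence on \<open>m\<close> over to the alternating sums in (ii), with an
  unknown coefficient that is read off at \<open>m = 4\<close>, where the alternating sum has a closed form.
  For \<open>m = 1\<close>, a convolution of central binomial coefficients again leads to the vanishing
  logarithm; its term \<open>j = 1\<close> deviates and produces the right-hand side of (iii).
\<close>

section \<open>Rational numbers that are integral at 3\<close>

text \<open>The localization of the integers at the prime 3. Fractions need not be in lowest terms,
  so closure under the ring operations only uses that 3 is prime.\<close>

definition Z3 :: "rat set" where
  "Z3 = {of_int a / of_int b | a b. \<not> 3 dvd b}"

text \<open>Stands for 3-adic order at least \<open>e\<close>, with 0 included without a case
  distinction.\<close>

definition pow3_dvd :: "nat \<Rightarrow> rat \<Rightarrow> bool" where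
  "pow3_dvd e x \<longleftrightarrow> x / 3 ^ e \<in> Z3"

lemma Z3_I: "\<not> 3 dvd b \<Longrightarrow> x = of_int a / of_int b \<Longrightarrow> x \<in> Z3"
  unfolding Z3_def by blast

lemma Z3_E:
  assumes "x \<in> Z3" obtains a b where "\<not> 3 dvd b" "b \<noteq> 0" "x = of_int a / of_int b"
proof -
  from assms obtain a b where "\<not> 3 dvd b" "x = of_int a / of_int b" unfolding Z3_def by blast
  moreover from this have "b \<noteq> 0" by auto
  ultimately show ?thesis using that by blast
qed

lemma not_3_dvd_mult: "\<not> 3 dvd b \<Longrightarrow> \<not> 3 dvd d \<Longrightarrow> \<not> 3 dvd b * (d::int)"
  by (simp add: prime_dvd_mult_iff)

lemma Z3_of_int [simp]: "of_int a \<in> Z3"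
  by (rule Z3_I[of 1 _ a]) auto

lemma Z3_of_nat [simp]: "of_nat a \<in> Z3"
  using Z3_of_int[of "int a"] by simp

lemma Z3_numeral [simp]: "numeral k \<in> Z3"
  using Z3_of_int[of "numeral k"] by simp

lemma Z3_0 [simp]: "0 \<in> Z3" and Z3_1 [simp]: "1 \<in> Z3"
  using Z3_of_int[of 0] Z3_of_int[of 1] by simp_all

lemma Z3_mult [intro]: "x \<in> Z3 \<Longrightarrow> y \<in> Z3 \<Longrightarrow> x * y \<in> Z3"
proof (elim Z3_E)
  fix a b c d :: int
  assume "\<not> 3 dvd b" "\<not> 3 dvd d" "x = of_int a / of_int b" "y = of_int c / of_int d"
  then show ?thesis by (intro Z3_I[of "b * d" _ "a * c"] not_3_dvd_mult) auto
qed

lemma Z3_add [intro]: "x \<in> Z3 \<Longrightarrow> y \<in> Z3 \<Longrightarrow> x + y \<in> Z3"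
proof (elim Z3_E)
  fix a b c d :: int
  assume "\<not> 3 dvd b" "\<not> 3 dvd d" "x = of_int a / of_int b" "y = of_int c / of_int d"
    "b \<noteq> 0" "d \<noteq> 0"
  then show ?thesis
    by (intro Z3_I[of "b * d" _ "a * d + c * b"] not_3_dvd_mult) (auto simp: field_simps)
qed

lemma Z3_uminus [intro]: "x \<in> Z3 \<Longrightarrow> - x \<in> Z3"
  using Z3_mult[of "of_int (- 1)" x] Z3_of_int[of "- 1"] by simp

lemma Z3_diff [intro]: "x \<in> Z3 \<Longrightarrow> y \<in> Z3 \<Longrightarrow> x - y \<in> Z3"
  using Z3_add[of x "- y"] by auto

lemma Z3_power [intro]: "x \<in> Z3 \<Longrightarrow> x ^ k \<in> Z3"
  by (induction k) auto

lemma Z3_sum [intro]: "(\<And>i. i \<in> A \<Longrightarrow> f i \<in> Z3) \<Longrightarrow> sum f A \<in> Z3"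
  by (induction A rule: infinite_finite_induct) auto

lemma Z3_divide_of_int: "x \<in> Z3 \<Longrightarrow> \<not> 3 dvd b \<Longrightarrow> x / of_int b \<in> Z3"
  using Z3_mult[of x "of_int 1 / of_int b"] Z3_I[of b _ 1] by auto

text \<open>A number congruent modulo 3 to an integer prime to 3 is a unit: its numerator
  \<open>3 * a + c * b\<close> is again prime to 3.\<close>

lemma Z3_divide_unit:
  assumes "x \<in> Z3" "pow3_dvd 1 (y - of_int c)" "\<not> 3 dvd c"
  shows "x / y \<in> Z3"
proof -
  obtain a b where *: "\<not> 3 dvd b" "b \<noteq> 0" "(y - of_int c) / 3 = of_int a / of_int b"
    using assms(2) unfolding pow3_dvd_def by (auto elim: Z3_E)
  then have y: "y = of_int (3 * a + c * b) / of_int b" by (simp add: field_simps)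
  have "\<not> 3 dvd c * b" using assms(3) *(1) by (rule not_3_dvd_mult)
  then have "\<not> 3 dvd 3 * a + c * b" by presburger
  then have "x * of_int b / of_int (3 * a + c * b) \<in> Z3"
    using assms(1) by (intro Z3_divide_of_int Z3_mult) auto
  then show ?thesis by (simp add: y)
qed

section \<open>Divisibility by powers of 3 in the localization\<close>

lemma pow3_dvd_0 [simp]: "pow3_dvd e 0"
  by (simp add: pow3_dvd_def)

lemma pow3_dvd_zero_exponent [simp]: "pow3_dvd 0 x \<longleftrightarrow> x \<in> Z3"
  by (simp add: pow3_dvd_def)

lemma pow3_dvd_add: "pow3_dvd e x \<Longrightarrow> pow3_dvd e y \<Longrightarrow> pow3_dvd e (x + y)"
  unfolding pow3_dvd_def by (auto simp: add_divide_distrib)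

lemma pow3_dvd_diff: "pow3_dvd e x \<Longrightarrow> pow3_dvd e y \<Longrightarrow> pow3_dvd e (x - y)"
  unfolding pow3_dvd_def by (auto simp: diff_divide_distrib)

lemma pow3_dvd_uminus: "pow3_dvd e x \<Longrightarrow> pow3_dvd e (- x)"
  using pow3_dvd_diff[of e 0 x] by simp

lemma pow3_dvd_sum: "(\<And>i. i \<in> A \<Longrightarrow> pow3_dvd e (f i)) \<Longrightarrow> pow3_dvd e (sum f A)"
  unfolding pow3_dvd_def by (auto simp: sum_divide_distrib)

lemma pow3_dvd_mult: "pow3_dvd d x \<Longrightarrow> pow3_dvd e y \<Longrightarrow> pow3_dvd (d + e) (x * y)"
  unfolding pow3_dvd_def using Z3_mult[of "x / 3 ^ d" "y / 3 ^ e"] by (simp add: power_add)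

lemma pow3_dvd_mult_left: "x \<in> Z3 \<Longrightarrow> pow3_dvd e y \<Longrightarrow> pow3_dvd e (x * y)"
  using pow3_dvd_mult[of 0 x e y] by simp

lemma pow3_dvd_mult_right: "pow3_dvd e x \<Longrightarrow> y \<in> Z3 \<Longrightarrow> pow3_dvd e (x * y)"
  using pow3_dvd_mult[of e x 0 y] by simp

lemma pow3_dvd_power: "pow3_dvd e (3 ^ e)"
  by (simp add: pow3_dvd_def)

lemma pow3_dvd_mono:
  assumes "pow3_dvd e x" "d \<le> e" shows "pow3_dvd d x"
proof -
  have "x / 3 ^ d = x / 3 ^ e * 3 ^ (e - d)"
    using assms(2) by (simp add: power_diff)
  also have "\<dots> \<in> Z3"
    using assms(1) unfolding pow3_dvd_def by (intro Z3_mult Z3_power) auto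
  finally show ?thesis unfolding pow3_dvd_def .
qed

lemma pow3_dvd_imp_Z3: "pow3_dvd e x \<Longrightarrow> x \<in> Z3"
  using pow3_dvd_mono[of e x 0] by simp

lemma pow3_dvd_of_int: "3 ^ e dvd (k::int) \<Longrightarrow> pow3_dvd e (of_int k)"
  by (auto simp: pow3_dvd_def elim!: dvdE)

lemma pow3_dvd_of_nat: "3 ^ e dvd k \<Longrightarrow> pow3_dvd e (of_nat k)"
  by (auto simp: pow3_dvd_def elim!: dvdE)

lemma pow3_dvd_divide: "pow3_dvd (d + e) x \<Longrightarrow> pow3_dvd e (x / 3 ^ d)"
  by (simp add: pow3_dvd_def power_add)

lemma pow3_dvd_power_mult_iff: "pow3_dvd (d + e) (3 ^ d * x) \<longleftrightarrow> pow3_dvd e x"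
  by (simp add: pow3_dvd_def power_add)

lemma pow3_dvd_divide_of_nat:
  assumes "pow3_dvd (multiplicity 3 n + c) x" "n > 0"
  shows "pow3_dvd c (x / of_nat n)"
proof -
  define d where "d = multiplicity 3 n"
  obtain q where q: "n = 3 ^ d * q" "\<not> 3 dvd q"
    using multiplicity_decompose'[of n 3] assms(2) by (auto simp: d_def)
  have "\<not> 3 dvd int q" using q(2) by presburger
  then have "x / 3 ^ (d + c) / of_int (int q) \<in> Z3"
    using assms(1) unfolding pow3_dvd_def d_def by (intro Z3_divide_of_int)
  also have "x / 3 ^ (d + c) / of_int (int q) = x / of_nat n / 3 ^ c"
    by (simp add: q power_add field_simps)
  finally show ?thesis by (simp add: pow3_dvd_def)
qed

text \<open>A positive index below \<open>3 ^ Suc e\<close> has at most \<open>e\<close> factors 3.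
  The later estimates of denominators rest on this.\<close>

lemma Z3_pow_divide_nat:
  assumes "0 < i" "i < 3 ^ Suc e"
  shows "3 ^ e / of_nat i \<in> Z3"
proof -
  define d where "d = multiplicity 3 i"
  obtain q where q: "i = 3 ^ d * q" "\<not> 3 dvd q"
    using multiplicity_decompose'[of i 3] assms(1) by (auto simp: d_def)
  have "q > 0" using q assms(1) by (cases q) auto
  then have "3 ^ d \<le> i" using q by simp
  then have "(3::nat) ^ d < 3 ^ Suc e" using assms(2) by linarith
  then have de: "d \<le> e" by (simp only: power_strict_increasing_iff one_less_numeral_iff
      less_Suc_eq_le rel_simps)
  have "\<not> 3 dvd int q" using q(2) by presburger
  then have "3 ^ (e - d) / of_int (int q) \<in> Z3"
    by (intro Z3_divide_of_int) auto
  also have "3 ^ (e - d) / of_int (int q) = (3 ^ e / of_nat i :: rat)"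
    using de by (simp add: q(1) power_diff field_simps)
  finally show ?thesis .
qed

lemma multiplicity_3_power_mult: "\<not> 3 dvd (q::int) \<Longrightarrow> multiplicity 3 (3 ^ e * q) = e"
  by (rule multiplicity_eqI) auto

text \<open>The factor \<open>3 ^ d\<close> makes room for negative orders: \<open>d = 1\<close>
  serves the bound in (ii), which can be -1, and \<open>d = 0\<close> everything else.\<close>

lemma padic_order_3_ge_iff:
  "Fin (int e - int d) \<le> padic_order 3 x \<longleftrightarrow> pow3_dvd e (3 ^ d * x)"
proof (cases "x = 0")
  case True
  then show ?thesis by (simp add: padic_order_def)
next
  case False
  obtain a b where ab: "quotient_of x = (a, b)" by force
  have b: "b > 0" "coprime a b" and x: "x = of_int a / of_int b"
    using ab quotient_of_denom_pos quotient_of_coprime quotient_of_div by blast+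
  have "a \<noteq> 0" using x False by auto
  define i j where "i = multiplicity 3 a" "j = multiplicity 3 b"
  obtain a' where a': "a = 3 ^ i * a'" "\<not> 3 dvd a'"
    using multiplicity_decompose'[of a 3] \<open>a \<noteq> 0\<close> by (auto simp: i_j_def)
  obtain b' where b': "b = 3 ^ j * b'" "\<not> 3 dvd b'"
    using multiplicity_decompose'[of b 3] b by (auto simp: i_j_def)
  have nz: "a' \<noteq> 0" "b' \<noteq> 0" using a' b' by auto
  have "Fin (int e - int d) \<le> padic_order 3 x \<longleftrightarrow> e + j \<le> d + i"
    using False ab by (auto simp: padic_order_def i_j_def)
  also have "\<dots> \<longleftrightarrow> pow3_dvd e (3 ^ d * x)"
  proof
    assume "e + j \<le> d + i"
    then obtain l where l: "d + i = e + j + l" using le_Suc_ex by blast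
    have "3 ^ d * x / 3 ^ e = 3 ^ (d + i) * of_int a' / (3 ^ (e + j) * of_int b')"
      by (simp add: x a' b' power_add field_simps)
    also have "\<dots> = of_int (3 ^ l * a') / of_int b'"
      unfolding l by (simp add: power_add nz)
    finally have "3 ^ d * x / 3 ^ e = of_int (3 ^ l * a') / of_int b'" .
    then show "pow3_dvd e (3 ^ d * x)"
      unfolding pow3_dvd_def using Z3_I b'(2) by metis
  next
    assume "pow3_dvd e (3 ^ d * x)"
    then obtain f g where fg: "\<not> 3 dvd g" "g \<noteq> 0" "3 ^ d * x / 3 ^ e = of_int f / of_int g"
      unfolding pow3_dvd_def by (auto elim: Z3_E)
    then have "of_int (3 ^ (d + i) * (a' * g)) = (of_int (3 ^ (e + j) * (b' * f)) :: rat)"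
      by (simp add: x a' b' nz field_simps power_add)
    then have eq: "3 ^ (d + i) * (a' * g) = 3 ^ (e + j) * (b' * f)"
      using of_int_eq_iff by blast
    have "d + i = multiplicity 3 (3 ^ (d + i) * (a' * g))"
      using multiplicity_3_power_mult[of "a' * g"] not_3_dvd_mult[of a' g] a' fg by simp
    moreover have "3 ^ (e + j) dvd 3 ^ (d + i) * (a' * g)" unfolding eq by simp
    moreover have "3 ^ (d + i) * (a' * g) \<noteq> 0" using nz fg by simp
    ultimately show "e + j \<le> d + i"
      by (metis multiplicity_geI zdvd1_eq abs_numeral numeral_eq_one_iff num.distinct(3))
  qed
  finally show ?thesis .
qed

section \<open>Sums of central binomial coefficients\<close>

definition central_binomial :: "nat \<Rightarrow> nat" where
  "central_binomial k = (2 * k) choose k"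

lemma central_binomial_0 [simp]: "central_binomial 0 = 1"
  by (simp add: central_binomial_def)

lemma central_binomial_pos [simp]: "central_binomial k > 0"
  by (simp add: central_binomial_def)

lemma central_binomial_Suc:
  "Suc k * central_binomial (Suc k) = 2 * (2 * k + 1) * central_binomial k"
proof -
  have "Suc k * (Suc (2 * k + 1) choose Suc k) = Suc (2 * k + 1) * ((2 * k + 1) choose k)"
    by (rule Suc_times_binomial)
  also have "(2 * k + 1) choose k = (2 * k + 1) choose Suc k"
    using binomial_symmetric[of k "2 * k + 1"] by simp
  finally have "Suc k * central_binomial (Suc k) = 2 * (Suc k * ((2 * k + 1) choose Suc k))"
    by (simp add: central_binomial_def)
  also have "Suc k * ((2 * k + 1) choose Suc k) = (2 * k + 1) * central_binomial k"
    using Suc_times_binomial[of k "2 * k"] by (simp add: central_binomial_def)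
  finally show ?thesis by simp
qed

lemma central_binomial_Suc_field:
  "of_nat (Suc k) * of_nat (central_binomial (Suc k)) =
     2 * (2 * of_nat k + 1) * (of_nat (central_binomial k) :: 'a :: field_char_0)"
  using arg_cong[OF central_binomial_Suc[of k], of "of_nat :: nat \<Rightarrow> 'a"]
  by (simp add: algebra_simps)

text \<open>These are the coefficients of \<open>1 / sqrt (1 - 4 * x)\<close>.\<close>

lemma central_binomial_gbinomial:
  "of_nat (central_binomial k) = (- 4) ^ k * ((- 1 / 2 :: 'a :: field_char_0) gchoose k)"
proof (induction k)
  case (Suc k)
  have "(of_nat (Suc k) :: 'a) * of_nat (central_binomial (Suc k)) =
      2 * (2 * of_nat k + 1) * ((- 4) ^ k * ((- 1 / 2) gchoose k))"
    by (simp only: central_binomial_Suc_field Suc.IH)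
  also have "\<dots> = (- 4) ^ Suc k * ((- 1 / 2 - of_nat k) * ((- 1 / 2) gchoose k))"
    by (simp add: algebra_simps)
  also have "(- 1 / 2 - of_nat k) * ((- 1 / 2 :: 'a) gchoose k) =
      of_nat (Suc k) * ((- 1 / 2) gchoose Suc k)"
    using gbinomial_mult_1[of "- 1 / 2 :: 'a" k] by (simp add: left_diff_distrib del: of_nat_Suc)
  also have "(- 4) ^ Suc k * (of_nat (Suc k) * ((- 1 / 2) gchoose Suc k)) =
      (of_nat (Suc k) :: 'a) * ((- 4) ^ Suc k * ((- 1 / 2) gchoose Suc k))"
    by (simp only: mult.left_commute)
  finally show ?case by (simp only: mult_cancel_left of_nat_eq_0_iff nat.distinct simp_thms)
qed simp

text \<open>In generating functions, the factor \<open>j choose i\<close> turns the power -1/2 of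
  \<open>1 - 4 * x\<close> into \<open>central_binomial i * x ^ i\<close> times the power -1/2 - i.
  Multiplying by \<open>1 / sqrt (1 - 4 * x)\<close> gives the power -1 - i, whose coefficients are
  ordinary binomials.\<close>

lemma sum_central_binomial_convolution:
  assumes "i \<le> N"
  shows "(\<Sum>j=i..N. central_binomial j * (j choose i) * central_binomial (N - j)) =
     4 ^ (N - i) * (N choose i) * central_binomial i"
proof -
  let ?b = "- 1 / 2 :: rat"
  have "of_nat (\<Sum>j=i..N. central_binomial j * (j choose i) * central_binomial (N - j)) =
      (\<Sum>j=i..N. (- 4) ^ N * (?b gchoose i) *
         ((?b - of_nat i gchoose (j - i)) * (?b gchoose (N - j))))"
    unfolding of_nat_sum
  proof (intro sum.cong refl, goal_cases)
    case (1 j)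
    then have ij: "i \<le> j" "j \<le> N" by auto
    have "of_nat (central_binomial j * (j choose i) * central_binomial (N - j)) =
        ((- 4) ^ j * (- 4) ^ (N - j)) * ((?b gchoose j) * (of_nat j gchoose i)) *
          (?b gchoose (N - j))"
      by (simp add: central_binomial_gbinomial binomial_gbinomial)
    also have "(- 4) ^ j * (- 4) ^ (N - j) = ((- 4) ^ N :: rat)"
      using ij by (simp flip: power_add)
    also have "(?b gchoose j) * (of_nat j gchoose i) =
        (?b gchoose i) * (?b - of_nat i gchoose (j - i))"
      using ij by (intro gbinomial_trinomial_revision)
    finally show ?case by (simp add: mult_ac)
  qed
  also have "\<dots> = (- 4) ^ N * (?b gchoose i) *
      (\<Sum>k=0..N - i. (?b - of_nat i gchoose k) * (?b gchoose (N - i - k)))"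
    unfolding sum_distrib_left using assms
    by (intro sum.reindex_bij_witness[of _ "\<lambda>k. k + i" "\<lambda>j. j - i"]) auto
  \<comment> \<open>Vandermonde adds the exponents -1/2 - i and -1/2 to a negative integer.\<close>
  also have "(\<Sum>k=0..N - i. (?b - of_nat i gchoose k) * (?b gchoose (N - i - k))) =
      (- (of_nat i + 1)) gchoose (N - i)"
    by (subst gbinomial_Vandermonde) (simp add: algebra_simps)
  also have "\<dots> = (- 1) ^ (N - i) * (of_nat N gchoose (N - i))"
    using assms by (subst gbinomial_minus) (simp add: of_nat_diff)
  also have "of_nat N gchoose (N - i) = (of_nat (N choose i) :: rat)"
    using assms by (simp add: binomial_symmetric[of i N] flip: binomial_gbinomial)
  also have "(- 4) ^ N * (?b gchoose i) * ((- 1) ^ (N - i) * of_nat (N choose i)) =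
      ((- 4) ^ i * (?b gchoose i)) * ((- 4) ^ (N - i) * (- 1) ^ (N - i)) * of_nat (N choose i)"
    using assms by (simp add: mult_ac flip: power_add)
  also have "((- 4) ^ (N - i) * (- 1) ^ (N - i) :: rat) = 4 ^ (N - i)"
    by (simp flip: power_mult_distrib)
  also have "(- 4) ^ i * (?b gchoose i) = of_nat (central_binomial i)"
    by (simp add: central_binomial_gbinomial)
  finally have "of_nat (\<Sum>j=i..N. central_binomial j * (j choose i) * central_binomial (N - j)) =
      (of_nat (4 ^ (N - i) * (N choose i) * central_binomial i) :: rat)"
    by (simp add: mult_ac)
  then show ?thesis by (simp only: of_nat_eq_iff)
qed

text \<open>Both sides are the coefficient of \<open>x ^ N\<close> in
  \<open>1 / sqrt ((1 - 4 * m * x) * (1 - 4 * (m - 4) * x))\<close>.\<close>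

lemma sum_alternating_central_binomial:
  fixes m :: "'a :: field_char_0"
  shows "4 ^ N * (\<Sum>k\<le>N. (- 1) ^ k * of_nat (N choose k) * of_nat (central_binomial k) *
      m ^ (N - k)) =
    (\<Sum>j\<le>N. of_nat (central_binomial j) * of_nat (central_binomial (N - j)) * (m - 4) ^ j * m ^
        (N - j))"
proof -
  have "(\<Sum>j\<le>N. of_nat (central_binomial j) * of_nat (central_binomial (N - j)) * (m - 4) ^ j *
      m ^ (N - j)) =
    (\<Sum>j\<le>N. \<Sum>i\<le>j. (- 4) ^ i * m ^ (N - i) *
       of_nat (central_binomial j * (j choose i) * central_binomial (N - j)))"
  proof (intro sum.cong refl, goal_cases)
    case (1 j)
    \<comment> \<open>Once \<open>(m - 4) ^ j\<close> is expanded and the sums are exchanged, the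
      inner sum is the convolution above.\<close>
    have "(m - 4) ^ j * m ^ (N - j) = ((- 4) + m) ^ j * m ^ (N - j)" by (simp add: algebra_simps)
    also have "\<dots> = (\<Sum>i\<le>j. of_nat (j choose i) * (- 4) ^ i * (m ^ (j - i) * m ^ (N - j)))"
      by (subst binomial_ring) (simp add: sum_distrib_left sum_distrib_right mult_ac)
    also have "\<dots> = (\<Sum>i\<le>j. of_nat (j choose i) * (- 4) ^ i * m ^ (N - i))"
      using 1 by (intro sum.cong refl) (simp flip: power_add)
    finally show ?case by (simp add: mult.assoc) (simp add: sum_distrib_left mult_ac)
  qed
  also have "\<dots> = (\<Sum>i\<le>N. \<Sum>j=i..N. (- 4) ^ i * m ^ (N - i) *
       of_nat (central_binomial j * (j choose i) * central_binomial (N - j)))"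
    unfolding sum.Sigma[OF finite_atMost ballI[OF finite_atMost]]
      sum.Sigma[OF finite_atMost ballI[OF finite_atLeastAtMost]]
    by (rule sum.reindex_bij_witness[of _ prod.swap prod.swap]) auto
  also have "\<dots> = (\<Sum>i\<le>N. (- 4) ^ i * m ^ (N - i) *
       of_nat (4 ^ (N - i) * (N choose i) * central_binomial i))"
    by (intro sum.cong refl)
      (simp only: atMost_iff flip: sum_central_binomial_convolution sum_distrib_left of_nat_sum)
  also have "\<dots> = (\<Sum>i\<le>N. 4 ^ N *
      ((- 1) ^ i * of_nat (N choose i) * of_nat (central_binomial i) * m ^ (N - i)))"
  proof (intro sum.cong refl, goal_cases)
    case (1 i)
    have "(- 4) ^ i * 4 ^ (N - i) = (- 1) ^ i * (4 ^ i * 4 ^ (N - i) :: 'a)"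
      by (simp flip: power_mult_distrib)
    also have "\<dots> = (- 1) ^ i * 4 ^ N" using 1 by (simp flip: power_add)
    finally show ?case by (simp add: mult_ac)
  qed
  finally show ?thesis by (simp add: sum_distrib_left)
qed

text \<open>The integral of \<open>(m + (4 - m) * t ^ 2) ^ N\<close> over \<open>t\<close> from 0 to
  1, written out termwise so that it makes sense in every field of characteristic 0.\<close>

definition odd_sum :: "nat \<Rightarrow> 'a \<Rightarrow> 'a :: field_char_0" where
  "odd_sum N m = (\<Sum>j\<le>N. of_nat (N choose j) * (4 - m) ^ j * m ^ (N - j) / of_nat (2 * j + 1))"

text \<open>Integration by parts for this integral, with boundary value \<open>4 ^ Suc N\<close> at
  \<open>t = 1\<close>. The proof compares the terms with equal powers of
  \<open>4 - m\<close>.\<close>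

lemma odd_sum_Suc: "of_nat (2 * N + 3) * odd_sum (Suc N) m =
    2 * of_nat (Suc N) * m * odd_sum N m + 4 ^ Suc N"
proof -
  let ?t = "\<lambda>j. (4 - m) ^ j * m ^ (Suc N - j) / of_nat (2 * j + 1)"
  have "2 * of_nat (Suc N) * m * odd_sum N m =
      (\<Sum>j\<le>N. 2 * of_nat (Suc N) * m *
          (of_nat (N choose j) * (4 - m) ^ j * m ^ (N - j) / of_nat (2 * j + 1)))"
    by (simp only: odd_sum_def sum_distrib_left)
  also have "\<dots> = (\<Sum>j\<le>N. 2 * of_nat ((Suc N - j) * (Suc N choose j)) * ?t j)"
  proof (intro sum.cong refl, goal_cases)
    case (1 j)
    then have "m ^ (Suc N - j) = m * m ^ (N - j)" by (simp add: Suc_diff_le)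
    moreover have "(Suc N - j) * (Suc N choose j) = Suc N * (N choose j)"
      using binomial_absorb_comp[of "Suc N" j] by simp
    ultimately show ?case by (simp only: of_nat_mult mult_ac times_divide_eq_right)
  qed
  \<comment> \<open>The added summand \<open>j = Suc N\<close> has the factor
    \<open>Suc N - j = 0\<close>.\<close>
  also have "\<dots> = (\<Sum>j\<le>Suc N. 2 * of_nat ((Suc N - j) * (Suc N choose j)) * ?t j)"
    by simp
  finally have "2 * of_nat (Suc N) * m * odd_sum N m =
      (\<Sum>j\<le>Suc N. 2 * of_nat ((Suc N - j) * (Suc N choose j)) * ?t j)" .
  moreover have "(4 :: 'a) ^ Suc N = ((4 - m) + m) ^ Suc N"
    by simp
  then have "(4 :: 'a) ^ Suc N = (\<Sum>j\<le>Suc N. of_nat (Suc N choose j) * of_nat (2 * j + 1) * ?t j)"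
    by (subst (asm) binomial_ring)
        (simp del: of_nat_Suc of_nat_add power_Suc sum.atMost_Suc add: mult_ac)
  ultimately have "2 * of_nat (Suc N) * m * odd_sum N m + 4 ^ Suc N =
     (\<Sum>j\<le>Suc N. of_nat (2 * ((Suc N - j) * (Suc N choose j)) + (Suc N choose j) * (2 * j + 1)) *
         ?t j)"
    by (simp only: sum.distrib[symmetric] of_nat_add of_nat_mult of_nat_numeral distrib_right)
  also have "\<dots> = (\<Sum>j\<le>Suc N. of_nat ((2 * N + 3) * (Suc N choose j)) * ?t j)"
  proof (intro sum.cong refl, goal_cases)
    case (1 j)
    then obtain l where "Suc N = j + l" using le_Suc_ex by auto
    \<comment> \<open>The two weights of a term add up to a value independent of
      \<open>j\<close>.\<close>
    then have "2 * (Suc N - j) + (2 * j + 1) = 2 * N + 3" by simp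
    then have "2 * ((Suc N - j) * (Suc N choose j)) + (Suc N choose j) * (2 * j + 1) =
      (2 * N + 3) * (Suc N choose j)" by (metis distrib_right mult.assoc mult.commute)
    then show ?case by (simp only:)
  qed
  also have "\<dots> = of_nat (2 * N + 3) * odd_sum (Suc N) m"
    unfolding odd_sum_def sum_distrib_left
    by (simp only: of_nat_mult times_divide_eq_right mult.assoc)
  finally show ?thesis by simp
qed

text \<open>Both sides satisfy the same first-order recurrence in \<open>N\<close>, which for the
  right-hand side is \<open>odd_sum_Suc\<close>.\<close>

lemma sum_central_binomial_eq_odd_sum:
  fixes m :: "'a :: field_char_0"
  shows "2 * 4 ^ N * (\<Sum>k\<le>N. of_nat (central_binomial k) * m ^ (N - k)) =
     of_nat (Suc N) * of_nat (central_binomial (Suc N)) * odd_sum N m"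
proof (induction N)
  case 0
  then show ?case by (simp add: odd_sum_def central_binomial_def)
next
  case (Suc N)
  let ?S = "\<lambda>N. \<Sum>k\<le>N. of_nat (central_binomial k) * m ^ (N - k)"
  let ?c = "of_nat (central_binomial (Suc N)) :: 'a"
  have "?S (Suc N) = m * ?S N + ?c"
    by (simp add: sum_distrib_left Suc_diff_le mult_ac)
  then have "2 * 4 ^ Suc N * ?S (Suc N) = 4 * m * (2 * 4 ^ N * ?S N) + 2 * 4 ^ Suc N * ?c"
    by (simp add: algebra_simps)
  also have "\<dots> = 2 * ?c * (2 * of_nat (Suc N) * m * odd_sum N m + 4 ^ Suc N)"
    unfolding Suc.IH by (simp add: algebra_simps)
  also have "\<dots> = 2 * of_nat (2 * N + 3) * ?c * odd_sum (Suc N) m"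
    unfolding odd_sum_Suc[symmetric] by (simp only: mult_ac)
  also have "2 * of_nat (2 * N + 3) * ?c =
      of_nat (Suc (Suc N)) * of_nat (central_binomial (Suc (Suc N)))"
    by (subst central_binomial_Suc_field) simp
  finally show ?case .
qed

section \<open>Alternating binomial sums and powers of 1 + sqrt(-3)\<close>

lemma of_nat_binomial_Suc:
  assumes "n > 0"
  shows "of_nat (n choose Suc i) =
    of_nat n * of_nat ((n - 1) choose i) / (of_nat (Suc i) :: 'a :: field_char_0)"
proof -
  obtain N where n: "n = Suc N" using assms by (cases n) auto
  have "of_nat (Suc i * (n choose Suc i)) = (of_nat (n * ((n - 1) choose i)) :: 'a)"
    using Suc_times_binomial[of i N] by (simp only: n diff_Suc_1)
  then show ?thesis
    by (metis of_nat_mult of_nat_neq_0 nonzero_mult_div_cancel_left)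
qed

text \<open>Abel summation: the signed binomials satisfy
  \<open>b i - b (Suc i) = n * b i / Suc i\<close>, which turns the partial sums of \<open>c\<close>
  into means. This carries results on (i) over to (ii).\<close>

lemma sum_alternating_binomial_by_parts:
  fixes c :: "nat \<Rightarrow> 'a :: field_char_0"
  assumes "n > 0"
  shows "(\<Sum>k<n. (- 1) ^ k * of_nat ((n - 1) choose k) * c k) / of_nat n =
     (\<Sum>i<n. (- 1) ^ i * of_nat ((n - 1) choose i) * ((\<Sum>k<Suc i. c k) / of_nat (Suc i)))"
proof -
  define b :: "nat \<Rightarrow> 'a" where "b k = (- 1) ^ k * of_nat ((n - 1) choose k)" for k
  obtain N where n: "n = Suc N" using assms by (cases n) auto
  have *: "(\<Sum>i<M. (b i - b (Suc i)) * (\<Sum>k<Suc i. c k)) = (\<Sum>k<M. b k * c k) - b M * (\<Sum>k<M. c k)"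
      for M
    by (induction M) (auto simp: algebra_simps)
  have "b i - b (Suc i) = (- 1) ^ i * of_nat (n choose Suc i)" for i
    by (simp add: b_def n algebra_simps)
  then have "b i - b (Suc i) = of_nat n * (b i / of_nat (Suc i))" for i
    using of_nat_binomial_Suc[OF assms, where 'a = 'a] by (simp add: b_def)
  moreover have "b n = 0" using n by (simp add: b_def)
  ultimately have "(\<Sum>k<n. b k * c k) =
      of_nat n * (\<Sum>i<n. b i * ((\<Sum>k<Suc i. c k) / of_nat (Suc i)))"
    using *[of n] by (simp add: sum_distrib_left mult_ac del: of_nat_Suc)
  then show ?thesis using assms by (simp add: b_def mult_ac)
qed

text \<open>The sum is \<open>n\<^sup>-\<^sup>1\<close> times the coefficient of \<open>\<surd>-3\<close> in \<open>(1 + \<surd>-3)\<^sup>n\<close>, and \<open>(1 + \<surd>-3)\<^sup>3 = -8\<close>.\<close>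

lemma sum_even_binomial_eq_0:
  assumes "3 dvd n" "n > 0"
  shows "(\<Sum>j<n. of_nat ((n - 1) choose (2 * j)) * (- 3) ^ j / of_nat (2 * j + 1)) =
      (0 :: 'a :: field_char_0)"
proof -
  \<comment> \<open>\<open>P k\<close> and \<open>Q k\<close> are the rational part and the
    coefficient of sqrt(-3) in the \<open>k\<close>-th power of 1 + sqrt(-3). For
    \<open>k \<le> n\<close> the cutoff at \<open>n\<close> loses nothing.\<close>
  define P :: "nat \<Rightarrow> 'a" where "P k = (\<Sum>j\<le>n. of_nat (k choose (2 * j)) * (- 3) ^ j)" for k
  define Q :: "nat \<Rightarrow> 'a" where "Q k = (\<Sum>j\<le>n. of_nat (k choose Suc (2 * j)) * (- 3) ^ j)" for k
  have Q_Suc: "Q (Suc k) = P k + Q k" for k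
    by (simp add: P_def Q_def algebra_simps sum.distrib)
  have P_Suc: "P (Suc k) = P k - 3 * Q k" if "k \<le> n" for k
  proof -
    obtain N where N: "n = Suc N" using \<open>n > 0\<close> by (cases n) auto
    have "P (Suc k) = 1 + (\<Sum>j\<le>N. of_nat (Suc k choose Suc (Suc (2 * j))) * (- 3) ^ Suc j)"
      unfolding P_def N sum.atMost_Suc_shift by simp
    also have "\<dots> = (1 + (\<Sum>j\<le>N. of_nat (k choose (2 * Suc j)) * (- 3) ^ Suc j))
        - 3 * (\<Sum>j\<le>N. of_nat (k choose Suc (2 * j)) * (- 3) ^ j)"
      by (simp add: algebra_simps sum.distrib sum_distrib_left sum_subtractf sum_negf)
    also have "1 + (\<Sum>j\<le>N. of_nat (k choose (2 * Suc j)) * (- 3) ^ Suc j) = P k"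
      unfolding P_def N sum.atMost_Suc_shift by simp
    also have "(\<Sum>j\<le>N. of_nat (k choose Suc (2 * j)) * (- 3) ^ j) = Q k"
      using that N by (simp add: Q_def)
    finally show ?thesis .
  qed
  have "Q (3 * k) = 0" if "3 * k \<le> n" for k using that
  proof (induction k)
    case 0
    then show ?case by (simp add: Q_def)
  next
    case (Suc k)
    have "3 * Suc k = Suc (Suc (Suc (3 * k)))" by simp
    \<comment> \<open>Three steps multiply by the cube of 1 + sqrt(-3), which is -8.\<close>
    then have "Q (3 * Suc k) = - 8 * Q (3 * k)"
      using Suc.prems by (simp only: Q_Suc P_Suc) (simp add: Q_Suc P_Suc)
    then show ?case using Suc by simp
  qed
  then have "Q n = 0" using assms(1) by (auto elim!: dvdE)
  moreover have "Q n = of_nat n *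
      (\<Sum>j<n. of_nat ((n - 1) choose (2 * j)) * (- 3) ^ j / of_nat (2 * j + 1))"
  proof -
    have "Q n = (\<Sum>j<n. of_nat (n choose Suc (2 * j)) * (- 3) ^ j)"
      unfolding Q_def lessThan_Suc_atMost[symmetric] by simp
    then show ?thesis
      unfolding of_nat_binomial_Suc[OF assms(2)] by (simp add: sum_distrib_left mult_ac)
  qed
  ultimately show ?thesis using assms(2) by simp
qed

section \<open>The logarithmic sum modulo powers of 3\<close>

lemma pow3_dvd_divide_unit:
  assumes "pow3_dvd e x" "pow3_dvd 1 (y - of_int c)" "\<not> 3 dvd c"
  shows "pow3_dvd e (x / y)"
  using Z3_divide_unit[of "x / 3 ^ e" y c] assms by (simp add: pow3_dvd_def mult.commute)

lemma minus_1_dvd_power_minus_1: "x - 1 dvd x ^ k - (1 :: 'a :: comm_ring_1)"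
  by (simp only: power_diff_1_eq dvd_triv_left)

lemma pow3_dvd_power_4_minus_1: "pow3_dvd 1 (4 ^ N - 1)"
  using pow3_dvd_of_int[of 1 "4 ^ N - 1"] minus_1_dvd_power_minus_1[of "4 :: int" N] by simp

lemma pow3_dvd_divide_power_4:
  assumes "pow3_dvd e x" shows "pow3_dvd e (x / 4 ^ N)"
  using pow3_dvd_divide_unit[OF assms, of "4 ^ N" 1] pow3_dvd_power_4_minus_1 by simp

text \<open>Bounds the 3-adic order of \<open>2 * j + 1\<close> by \<open>j div 2\<close>, so that
  at least half of the factors of \<open>3 ^ j\<close> survive division by
  \<open>2 * j + 1\<close>.\<close>

lemma double_plus_1_less_power_3: "2 \<le> j \<Longrightarrow> 2 * j + 1 < 3 ^ Suc (j div 2)"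
proof -
  assume j: "2 \<le> j"
  \<comment> \<open>Here \<open>e\<close> stands for \<open>j div 2\<close>, and
    \<open>2 * j + 1 \<le> 4 * e + 3\<close>.\<close>
  have "1 \<le> e \<Longrightarrow> 4 * e + 3 < (3 :: nat) ^ Suc e" for e
    by (induction e rule: dec_induct) auto
  from this[of "j div 2"] j show ?thesis by simp linarith
qed

lemma power_3_divide_odd:
  assumes "2 \<le> j"
  shows "pow3_dvd (j - j div 2) (3 ^ j / of_nat (2 * j + 1))"
proof -
  have "3 ^ (j div 2) / of_nat (2 * j + 1) \<in> Z3"
    using double_plus_1_less_power_3[OF assms] by (intro Z3_pow_divide_nat) auto
  then have "pow3_dvd (j - j div 2) (3 ^ (j - j div 2) * (3 ^ (j div 2) / of_nat (2 * j + 1)))"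
    by (intro pow3_dvd_mult_right pow3_dvd_power)
  then show ?thesis by (simp flip: power_add)
qed

text \<open>The quotient keeps \<open>j div 2\<close> factors 3, which are lent to \<open>c\<close>
  to make up for its denominators.\<close>

lemma power_3_divide_odd_mult:
  assumes "2 \<le> j" "pow3_dvd a (3 ^ (j div 2) * c)"
  shows "pow3_dvd a (3 ^ j / of_nat (2 * j + 1) * c)"
proof -
  have "pow3_dvd (j div 2) (3 ^ j / of_nat (2 * j + 1))"
    using power_3_divide_odd[OF assms(1)] by (rule pow3_dvd_mono) linarith
  then have "3 ^ j / of_nat (2 * j + 1) / 3 ^ (j div 2) \<in> Z3"
    by (simp only: pow3_dvd_def)
  from pow3_dvd_mult_left[OF this assms(2)] show ?thesis by simp
qed

text \<open>The premise bounds \<open>2 * j\<close> and not \<open>2 * j + 1\<close>, so that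
  \<open>e = 0\<close> is admissible at \<open>j = 1\<close>, where the quotient is exactly
  1.\<close>

lemma power_3_divide_odd_mult':
  assumes "\<And>e. 2 * j < 3 ^ Suc e \<Longrightarrow> pow3_dvd a (3 ^ e * c)"
  shows "pow3_dvd a (3 ^ j / of_nat (2 * j + 1) * c)"
proof -
  consider "j = 0" | "j = 1" | "2 \<le> j" by linarith
  then show ?thesis
  proof cases
    case 3
    then have "2 * j < 3 ^ Suc (j div 2)" using double_plus_1_less_power_3[of j] by linarith
    with 3 show ?thesis by (intro power_3_divide_odd_mult assms)
  qed (use assms[of 0] in simp_all)
qed

lemma power_3_divide_odd_in_Z3: "3 ^ j / of_nat (2 * j + 1) \<in> Z3"
proof -
  have "pow3_dvd 0 (3 ^ j / of_nat (2 * j + 1) * 1)"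
    by (rule power_3_divide_odd_mult') auto
  then show ?thesis by (simp only: pow3_dvd_zero_exponent mult_1_right)
qed

text \<open>The signed binomial is the product of \<open>1 - n / k\<close> for \<open>k\<close> from
  1 to \<open>i\<close>, and each \<open>n / k\<close> loses at most \<open>e\<close> of the factors
  3 of \<open>n\<close>.\<close>

lemma binomial_near_one:
  assumes "3 ^ a dvd n" "n > 0" "i < 3 ^ Suc e"
  shows "pow3_dvd a (3 ^ e * ((- 1) ^ i * of_nat ((n - 1) choose i) - 1))"
  using assms(3)
proof (induction i)
  case (Suc i)
  obtain N where n: "n = Suc N" using assms(2) by (cases n) auto
  have "of_nat ((n - 1) choose Suc i) =
      (of_nat n * of_nat ((n - 1) choose i) / of_nat (Suc i) - of_nat ((n - 1) choose i) :: rat)"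
    using of_nat_binomial_Suc[OF assms(2), of i, where 'a = rat] by (simp add: n del: of_nat_Suc)
  then have "3 ^ e * ((- 1) ^ Suc i * of_nat ((n - 1) choose Suc i) - 1) =
      3 ^ e * ((- 1) ^ i * of_nat ((n - 1) choose i) - 1) -
      (3 ^ e / of_nat (Suc i)) * (of_nat n *
          ((- 1) ^ i * of_nat ((n - 1) choose i :: nat) :: rat))"
    by (simp only:) (simp add: algebra_simps del: of_nat_Suc)
  also have "pow3_dvd a \<dots>"
  proof (rule pow3_dvd_diff)
    show "pow3_dvd a (3 ^ e * ((- 1) ^ i * of_nat ((n - 1) choose i) - 1))"
      using Suc by simp
    show "pow3_dvd a (3 ^ e / of_nat (Suc i) *
        (of_nat n * ((- 1) ^ i * of_nat ((n - 1) choose i))))"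
      using Suc.prems by (intro pow3_dvd_mult_left[OF Z3_pow_divide_nat] pow3_dvd_mult_right
        pow3_dvd_of_nat assms Z3_mult Z3_power Z3_uminus) auto
  qed
  finally show ?case .
qed simp

text \<open>Comparison with the vanishing sum in \<open>sum_even_binomial_eq_0\<close>: its
  binomials have even lower index and are close to 1, and \<open>3 ^ j / (2 * j + 1)\<close> pays
  for the lost factors.\<close>

lemma truncated_log_pow3_dvd:
  assumes "3 ^ a dvd n" "n > 0"
  shows "pow3_dvd a (\<Sum>j<n. (- 3) ^ j / of_nat (2 * j + 1))"
proof -
  have eq: "(- 3) ^ j / of_nat (2 * j + 1) * x =
      3 ^ j / of_nat (2 * j + 1) * ((- 1) ^ j * x :: rat)" for j x
    by (simp add: power_minus[of 3])
  show ?thesis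
  proof (cases "a = 0")
    \<comment> \<open>Only integrality is claimed here; the vanishing sum is used once
      \<open>3 dvd n\<close>.\<close>
    case True
    have "(- 3) ^ j / of_nat (2 * j + 1) \<in> Z3" for j
      using eq[of j 1] power_3_divide_odd_in_Z3[of j]
      by (simp only: mult_1_right) (intro Z3_mult Z3_power Z3_uminus; simp)
    with True show ?thesis by auto
  next
    case False
    then have "3 dvd n" using assms(1) dvd_trans dvd_power[of a 3] by blast
    then have "(\<Sum>j<n. (- 3) ^ j / of_nat (2 * j + 1)) =
        - (\<Sum>j<n. (- 3) ^ j / of_nat (2 * j + 1) * (of_nat ((n - 1) choose (2 * j)) - 1) :: rat)"
      using sum_even_binomial_eq_0[of n, where 'a = rat] assms(2)
      by (simp add: algebra_simps sum_subtractf diff_divide_distrib)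
    also have "pow3_dvd a \<dots>"
    proof (intro pow3_dvd_uminus pow3_dvd_sum)
      fix j
      have "pow3_dvd a ((- 1) ^ j * (3 ^ e * (of_nat ((n - 1) choose (2 * j)) - 1)))"
        if "2 * j < 3 ^ Suc e" for e
        using binomial_near_one[OF assms that]
        by (simp add: pow3_dvd_mult_left Z3_power Z3_uminus)
      then show "pow3_dvd a ((- 3) ^ j / of_nat (2 * j + 1) *
          (of_nat ((n - 1) choose (2 * j)) - 1))"
        unfolding eq by (intro power_3_divide_odd_mult') (simp add: mult.left_commute)
    qed
    finally show ?thesis .
  qed
qed

text \<open>At \<open>m = 1\<close> one has \<open>4 - m = 3\<close>, and replacing each binomial by
  \<open>(- 1) ^ j\<close> leaves the truncated logarithm.\<close>

lemma odd_sum_1_pow3_dvd: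
  assumes "3 ^ a dvd n" "n > 0"
  shows "pow3_dvd a (odd_sum (n - 1) 1)"
proof -
  have "odd_sum (n - 1) 1 = (\<Sum>j<n. of_nat ((n - 1) choose j) * 3 ^ j / of_nat (2 * j + 1) :: rat)"
    using assms(2) by (cases n) (auto simp: odd_sum_def lessThan_Suc_atMost)
  also have "\<dots> = (\<Sum>j<n. (- 3) ^ j / of_nat (2 * j + 1)) +
      (\<Sum>j<n. 3 ^ j / of_nat (2 * j + 1) *
          ((- 1) ^ j * ((- 1) ^ j * of_nat ((n - 1) choose j) - 1)))"
    unfolding sum.distrib[symmetric]
  proof (intro sum.cong refl)
    fix j
    have "(- 1) ^ j * ((- 1) ^ j * x - 1) = x - (- 1) ^ j" for x :: rat
      by (simp add: right_diff_distrib flip: mult.assoc power_add)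
    then show "of_nat ((n - 1) choose j) * 3 ^ j / of_nat (2 * j + 1) =
        (- 3) ^ j / of_nat (2 * j + 1) +
      3 ^ j / of_nat (2 * j + 1) * ((- 1) ^ j * ((- 1) ^ j * of_nat ((n - 1) choose j) - 1) ::
          rat)"
      by (simp only: power_minus[of 3]) (simp add: algebra_simps diff_divide_distrib)
  qed
  also have "pow3_dvd a \<dots>"
  proof (rule pow3_dvd_add[OF truncated_log_pow3_dvd[OF assms] pow3_dvd_sum], rule
      power_3_divide_odd_mult')
    fix j e :: nat
    assume "2 * j < 3 ^ Suc e"
    then have "pow3_dvd a ((- 1) ^ j * (3 ^ e * ((- 1) ^ j * of_nat ((n - 1) choose j) - 1)))"
      by (intro pow3_dvd_mult_left binomial_near_one assms Z3_power Z3_uminus) auto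
    then show "pow3_dvd a (3 ^ e * ((- 1) ^ j * ((- 1) ^ j * of_nat ((n - 1) choose j) - 1)))"
      by (simp only: mult.left_commute)
  qed
  finally show ?thesis .
qed

text \<open>Put \<open>m = 1 + 3 * w\<close> and compare terms modulo \<open>3 * w\<close>. The term
  \<open>j = 0\<close> does not change, \<open>j = 1\<close> contains \<open>3 * (1 - w) / 3\<close>
  and yields the shift \<open>- N * w\<close>, and for \<open>j \<ge> 2\<close> the remaining
  factors change by a multiple of \<open>w\<close> while \<open>3 ^ j / (2 * j + 1)\<close> supplies
  the missing 3.\<close>

lemma odd_sum_cong:
  fixes m :: int
  assumes "3 ^ v dvd m - 1" "3 dvd m - 1"
  shows "pow3_dvd v (odd_sum N (of_int m) - odd_sum N 1 + of_nat N * (of_int (m - 1) / 3))"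
proof -
  obtain w where w: "m = 1 + 3 * w" using assms(2) by (metis dvdE diff_add_cancel add.commute)
  have v: "pow3_dvd v (3 * of_int w)"
    using pow3_dvd_of_int[OF assms(1)] by (simp add: w)
  \<comment> \<open>The change of the \<open>j\<close>-th term without its binomial, with the shift
    \<open>- w\<close> at \<open>j = 1\<close> compensated.\<close>
  define d where "d j = ((4 - of_int m) ^ j * of_int m ^ (N - j) - 3 ^ j) / of_nat (2 * j + 1)
    + (if j = 1 then of_int w else 0 :: rat)" for j
  have "odd_sum N (of_int m) - odd_sum N 1 + of_nat N * of_int w =
      (\<Sum>j\<le>N. of_nat (N choose j) * d j)"
  proof -
    have "(\<Sum>j\<le>N. of_nat (N choose j) * (if j = 1 then of_int w else 0 :: rat)) =
        (\<Sum>j\<le>N. if j = 1 then of_nat (N choose j) * of_int w else 0)"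
      by (intro sum.cong) auto
    also have "\<dots> = of_nat N * of_int w" by (cases N) auto
    finally show ?thesis
      unfolding d_def odd_sum_def by (simp add: distrib_left sum.distrib diff_divide_distrib
        right_diff_distrib sum_subtractf mult.assoc)
  qed
  also have "pow3_dvd v \<dots>"
  proof (intro pow3_dvd_sum pow3_dvd_mult_left Z3_of_nat)
    fix j assume "j \<in> {..N}"
    have dvd_m: "3 * w dvd m ^ k - 1" for k
      using minus_1_dvd_power_minus_1[of m k] by (simp add: w)
    have m4: "(4 - of_int m :: rat) = 3 * of_int (1 - w)" by (simp add: w)
    consider "j = 0" | "j = 1" | "2 \<le> j" by linarith
    then show "pow3_dvd v (d j)"
    proof cases
      case 1
      obtain y where "m ^ N - 1 = 3 * w * y" using dvd_m by blast
      then have "of_int (m ^ N - 1) = (of_int (3 * w * y) :: rat)" by (simp only:)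
      then have "d j = 3 * of_int w * of_int y" by (simp add: d_def 1)
      then show ?thesis using v by (simp add: pow3_dvd_mult_right)
    next
      case 2
      obtain y where "m ^ (N - 1) - 1 = 3 * w * y" using dvd_m by blast
      then have "of_int (m ^ (N - 1) - 1) = (of_int (3 * w * y) :: rat)" by (simp only:)
      then have "of_int m ^ (N - 1) = (3 * of_int w * of_int y + 1 :: rat)"
        by (simp add: algebra_simps)
      then have "d j = 3 * of_int w * of_int (y * (1 - w))"
        unfolding d_def 2 m4 by (simp add: field_simps)
      then show ?thesis using v by (simp add: pow3_dvd_mult_right del: of_int_mult of_int_diff)
    next
      case 3
      have "w dvd m ^ (N - j) - 1" using dvd_m dvd_mult_right by blast
      moreover have "w dvd (1 - w) ^ j - 1"
        using minus_1_dvd_power_minus_1[of "1 - w" j] by simp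
      moreover have "(1 - w) ^ j * m ^ (N - j) - 1 =
          (1 - w) ^ j * (m ^ (N - j) - 1) + ((1 - w) ^ j - 1)"
        by (simp add: algebra_simps)
      ultimately have "w dvd (1 - w) ^ j * m ^ (N - j) - 1" by (metis dvd_add dvd_mult)
      then obtain y where "(1 - w) ^ j * m ^ (N - j) - 1 = w * y" by blast
      then have y: "of_int ((1 - w) ^ j * m ^ (N - j) - 1) = (of_int (w * y) :: rat)"
        by (simp only:)
      have "pow3_dvd 1 (3 ^ j / of_nat (2 * j + 1))"
        using power_3_divide_odd[OF 3] 3 by (elim pow3_dvd_mono) simp
      then have z: "3 ^ j / of_nat (2 * j + 1) / 3 \<in> Z3"
        by (simp add: pow3_dvd_def)
      have "d j = 3 ^ j / of_nat (2 * j + 1) * of_int ((1 - w) ^ j * m ^ (N - j) - 1)"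
        unfolding d_def m4 power_mult_distrib using 3
        by (simp add: algebra_simps diff_divide_distrib)
      also have "\<dots> = 3 * of_int w * (3 ^ j / of_nat (2 * j + 1) / 3 * of_int y)"
      proof -
        have "k * of_int (w * y) = 3 * of_int w * (k / 3 * of_int y)" for k :: rat by simp
        then show ?thesis unfolding y .
      qed
      finally show ?thesis using v z by (simp only: pow3_dvd_mult_right Z3_mult Z3_of_int)
    qed
  qed
  finally show ?thesis by (simp add: w)
qed

section \<open>Means of central binomial coefficients\<close>

definition central_mean :: "nat \<Rightarrow> int \<Rightarrow> rat" where
  "central_mean n m = (\<Sum>k<n. 1 / of_int m ^ k * of_nat (central_binomial k)) / of_nat n"

definition alternating_mean :: "nat \<Rightarrow> int \<Rightarrow> rat" where
  "alternating_mean n m = (\<Sum>k<n. (- 1) ^ k / of_int m ^ k * of_nat ((n - 1) choose k) *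
      of_nat (central_binomial k)) / of_nat n"

text \<open>The factor between \<open>central_mean\<close> and \<open>odd_sum\<close>, up to a power
  of \<open>m\<close>. It is integral at 3, and 1 modulo 3 when \<open>n = 3 ^ a\<close> with
  \<open>a \<ge> 1\<close>.\<close>

definition mean_factor :: "nat \<Rightarrow> rat" where
  "mean_factor n = of_nat (central_binomial n) / 2 / 4 ^ (n - 1)"

lemma Z3_half: "x \<in> Z3 \<Longrightarrow> x / 2 \<in> Z3"
  using Z3_divide_of_int[of x 2] by simp

lemma mean_factor_in_Z3: "mean_factor n \<in> Z3"
  using pow3_dvd_divide_power_4[of 0 "of_nat (central_binomial n) / 2" "n - 1"] Z3_half
  by (simp only: mean_factor_def pow3_dvd_zero_exponent Z3_of_nat)

lemma central_mean_eq_odd_sum: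
  assumes "n > 0" "m \<noteq> 0"
  shows "central_mean n m = mean_factor n * odd_sum (n - 1) (of_int m) / of_int m ^ (n - 1)"
proof -
  obtain N where n: "n = Suc N" using assms(1) by (cases n) auto
  have "central_mean n m = (\<Sum>k\<le>N. of_nat (central_binomial k) * of_int m ^ (N - k)) /
      of_int m ^ N / of_nat n"
    unfolding central_mean_def n lessThan_Suc_atMost sum_divide_distrib
  proof (intro sum.cong refl arg_cong2[of _ _ _ _ "(/)"])
    fix k assume "k \<in> {..N}"
    then have "(of_int m :: rat) ^ N = of_int m ^ k * of_int m ^ (N - k)"
      by (simp flip: power_add)
    then show "1 / of_int m ^ k * of_nat (central_binomial k) =
        of_nat (central_binomial k) * of_int m ^ (N - k) / (of_int m :: rat) ^ N"
      using assms(2) by simp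
  qed
  also have "(\<Sum>k\<le>N. of_nat (central_binomial k) * of_int m ^ (N - k)) =
      of_nat n * mean_factor n * odd_sum N (of_int m)"
    using sum_central_binomial_eq_odd_sum[of N "of_int m :: rat"]
    by (simp add: mean_factor_def n field_simps del: of_nat_Suc)
  finally show ?thesis using assms(1) by (simp add: n del: of_nat_Suc)
qed

lemma central_mean_1_pow3_dvd:
  assumes "3 ^ a dvd n" "n > 0"
  shows "pow3_dvd a (central_mean n 1)"
  using pow3_dvd_mult_left[OF mean_factor_in_Z3 odd_sum_1_pow3_dvd[OF assms]] assms(2)
  by (simp add: central_mean_eq_odd_sum)

lemma central_mean_cong:
  assumes "3 ^ v dvd m - 1" "3 dvd m - 1" "n > 0"
  shows "pow3_dvd v (central_mean n m - central_mean n 1 +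
      mean_factor n * of_nat (n - 1) * (of_int (m - 1) / 3))"
proof -
  let ?m = "of_int m :: rat" and ?N = "n - 1"
  have "\<not> 3 dvd m" using assms(2) by presburger
  then have "m \<noteq> 0" by auto
  have dvd_m: "pow3_dvd v (?m ^ ?N - 1)"
    using pow3_dvd_of_int[OF dvd_trans[OF assms(1) minus_1_dvd_power_minus_1[of m ?N]]] by simp
  have "m - 1 dvd m ^ ?N - 1" by (rule minus_1_dvd_power_minus_1)
  with assms(2) have "3 dvd m ^ ?N - 1" by (rule dvd_trans)
  then have unit: "pow3_dvd 1 (?m ^ ?N - of_int 1)"
    using pow3_dvd_of_int[of 1 "m ^ ?N - 1"] by simp
  have J1: "odd_sum ?N 1 \<in> Z3"
    using odd_sum_1_pow3_dvd[of 0 n] assms(3) by simp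
  obtain w where w: "m - 1 = 3 * w" using assms(2) by blast
  \<comment> \<open>The exponent 0 transfers integrality of \<open>odd_sum\<close> from 1 to
    \<open>m\<close>.\<close>
  have "pow3_dvd 0 (odd_sum ?N ?m - odd_sum ?N 1 + of_nat ?N * (of_int (m - 1) / 3))"
    by (rule odd_sum_cong) (use assms(2) in auto)
  from Z3_add[OF this[unfolded pow3_dvd_zero_exponent]
      Z3_diff[OF J1 Z3_mult[OF Z3_of_nat Z3_of_int]], of ?N w]
  have Jm: "odd_sum ?N ?m \<in> Z3" by (simp add: w)
  have "central_mean n m - mean_factor n * odd_sum ?N ?m =
      - (mean_factor n * odd_sum ?N ?m * (?m ^ ?N - 1) / ?m ^ ?N)"
    using \<open>m \<noteq> 0\<close> by (simp add: central_mean_eq_odd_sum assms(3) field_simps)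
  also have "pow3_dvd v \<dots>"
    by (intro pow3_dvd_uminus pow3_dvd_divide_unit[OF _ unit] pow3_dvd_mult_left Z3_mult
        mean_factor_in_Z3 Jm dvd_m) auto
  finally have "pow3_dvd v ((central_mean n m - mean_factor n * odd_sum ?N ?m) +
     mean_factor n * (odd_sum ?N ?m - odd_sum ?N 1 + of_nat ?N * (of_int (m - 1) / 3)))"
    by (intro pow3_dvd_add pow3_dvd_mult_left[OF mean_factor_in_Z3] odd_sum_cong assms)
  moreover have "central_mean n 1 = mean_factor n * odd_sum ?N 1" using assms(3)
    by (simp add: central_mean_eq_odd_sum)
  ultimately show ?thesis by (simp add: algebra_simps)
qed

lemma alternating_mean_eq_sum_central_mean:
    "n > 0 \<Longrightarrow> alternating_mean n m =
        (\<Sum>i<n. (- 1) ^ i * of_nat ((n - 1) choose i) * central_mean (Suc i) m)"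
  using sum_alternating_binomial_by_parts[of n
      "\<lambda>k. 1 / of_int m ^ k * of_nat (central_binomial k) :: rat"]
  by (simp add: alternating_mean_def central_mean_def mult_ac del: of_nat_Suc sum.lessThan_Suc)

text \<open>Summation by parts applied to \<open>central_mean_cong\<close>, with the linear
  coefficients collected in \<open>W\<close>. The point is that \<open>W\<close> is chosen before
  \<open>v\<close> and \<open>m\<close>, so it can be determined at a convenient
  \<open>m\<close>.\<close>

lemma alternating_mean_cong:
  assumes "n > 0"
  obtains W where "W \<in> Z3"
    "\<And>v m. 3 ^ v dvd m - 1 \<Longrightarrow> 3 dvd m - 1 \<Longrightarrow>
        pow3_dvd v (alternating_mean n m - alternating_mean n 1 - W * (of_int (m - 1) / 3))"
proof
  define W :: rat where "W = (\<Sum>i<n. (- 1) ^ i * of_nat ((n - 1) choose i) * -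
      (mean_factor (Suc i) * of_nat i))"
  have Z: "(- 1) ^ i * of_nat ((n - 1) choose i) \<in> Z3" for i
    by (intro Z3_mult Z3_power Z3_uminus) auto
  show "W \<in> Z3" unfolding W_def
    by (intro Z3_sum Z3_mult[OF Z] Z3_uminus Z3_mult[OF mean_factor_in_Z3] Z3_of_nat)
  fix v :: nat and m :: int assume m: "3 ^ v dvd m - 1" "3 dvd m - 1"
  have "alternating_mean n m - alternating_mean n 1 - W * (of_int (m - 1) / 3) =
     (\<Sum>i<n. (- 1) ^ i * of_nat ((n - 1) choose i) *
       (central_mean (Suc i) m - central_mean (Suc i) 1 + mean_factor (Suc i) * of_nat
           (Suc i - 1) * (of_int (m - 1) / 3)))"
    by (simp add: alternating_mean_eq_sum_central_mean assms W_def sum_distrib_right sum_negf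
        ring_distribs sum.distrib sum_subtractf mult.assoc
         del: of_int_diff of_nat_Suc)
  also have "pow3_dvd v \<dots>"
    by (intro pow3_dvd_sum pow3_dvd_mult_left[OF Z] central_mean_cong m) auto
  finally show "pow3_dvd v (alternating_mean n m - alternating_mean n 1 -
      W * (of_int (m - 1) / 3))" .
qed

lemma alternating_mean_1_in_Z3: "n > 0 \<Longrightarrow> alternating_mean n 1 \<in> Z3"
  using central_mean_1_pow3_dvd[of 0]
  by (auto simp: alternating_mean_eq_sum_central_mean intro!: Z3_sum Z3_mult Z3_power Z3_uminus)

lemma alternating_mean_eq_sum_central_binomial:
  assumes "n > 0" "m \<noteq> 0"
  shows "4 ^ (n - 1) * (of_int m ^ (n - 1) * (of_nat n * alternating_mean n m)) =
    (\<Sum>j<n. of_nat (central_binomial j) * of_nat (central_binomial (n - 1 - j)) *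
       (of_int m - 4) ^ j * of_int m ^ (n - 1 - j))"
proof -
  obtain N where n: "n = Suc N" using assms(1) by (cases n) auto
  have "of_int m ^ N * (of_nat n * alternating_mean n m) =
     (\<Sum>k\<le>N. of_int m ^ N *
         ((- 1) ^ k / of_int m ^ k * of_nat (N choose k) * of_nat (central_binomial k)))"
    unfolding alternating_mean_def n lessThan_Suc_atMost
    by (simp del: of_nat_Suc) (simp add: sum_distrib_left)
  also have "\<dots> = (\<Sum>k\<le>N. (- 1) ^ k * of_nat (N choose k) * of_nat (central_binomial k) *
      of_int m ^ (N - k))"
  proof (intro sum.cong refl)
    fix k assume "k \<in> {..N}"
    then have "(of_int m :: rat) ^ N = of_int m ^ k * of_int m ^ (N - k)"
      by (simp flip: power_add)
    then show "of_int m ^ N * ((- 1) ^ k / of_int m ^ k * of_nat (N choose k) *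
        of_nat (central_binomial k)) =
        (- 1) ^ k * of_nat (N choose k) * of_nat (central_binomial k) * (of_int m :: rat) ^
            (N - k)"
      using assms(2) by simp
  qed
  finally show ?thesis
    using sum_alternating_central_binomial[of N "of_int m :: rat"]
    by (simp add: n lessThan_Suc_atMost)
qed

lemma central_binomial_pred:
  assumes "n > 0"
  shows "(of_nat (central_binomial (n - 1)) :: rat) =
      of_nat n * of_nat (central_binomial n) / (2 * (2 * of_nat n - 1))"
proof -
  obtain N where n: "n = Suc N" using assms by (cases n) auto
  show ?thesis using central_binomial_Suc_field[of N, where 'a = rat] by (simp add: n field_simps)
qed

text \<open>The factor \<open>(m - 4) ^ j\<close> leaves only the term \<open>j = 0\<close>. The
  value is the Catalan number of index \<open>n - 1\<close> over \<open>4 ^ (n - 1)\<close>.\<close>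

lemma alternating_mean_4:
  assumes "n > 0"
  shows "alternating_mean n 4 =
      of_nat (central_binomial n) / 2 / (2 * of_nat n - 1) / 4 ^ (n - 1)"
proof -
  obtain N where n: "n = Suc N" using assms(1) by (cases n) auto
  have "4 ^ N * (4 ^ N * (of_nat n * alternating_mean n 4)) =
      4 ^ N * (of_nat (central_binomial N) :: rat)"
    using alternating_mean_eq_sum_central_binomial[OF assms, of 4]
    by (simp add: n sum.lessThan_Suc_shift del: of_nat_Suc sum.lessThan_Suc)
  then have "4 ^ N * (of_nat n * alternating_mean n 4) = of_nat (central_binomial N)" by simp
  also have "\<dots> = of_nat n * (of_nat (central_binomial n) / (2 * (2 * of_nat n - 1)))"
    using central_binomial_pred[OF assms] by (simp add: n)
  finally have "4 ^ N * alternating_mean n 4 =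
      of_nat (central_binomial n) / (2 * (2 * of_nat n - 1))"
    using assms by (simp only: mult.left_commute[of "4 ^ N"] mult_cancel_left) simp
  then have "alternating_mean n 4 =
      of_nat (central_binomial n) / (2 * (2 * of_nat n - 1)) / 4 ^ N"
    by (metis nonzero_mult_div_cancel_left power_not_zero zero_neq_numeral)
  then show ?thesis by (simp add: n)
qed

section \<open>The alternating mean at 1\<close>

text \<open>For fixed \<open>j\<close> this ratio tends to 1 as \<open>n\<close> tends to 0 in the 3-adic integers.\<close>

definition convolution_ratio :: "nat \<Rightarrow> nat \<Rightarrow> rat" where
  "convolution_ratio n j = of_nat (2 * j + 1) * of_nat (central_binomial j) *
     of_nat (central_binomial (n - 1 - j)) / of_nat (central_binomial (n - 1))"

lemma convolution_ratio_0: "convolution_ratio n 0 = 1"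
  using central_binomial_pos[of "n - 1"] by (simp add: convolution_ratio_def)

lemma convolution_ratio_Suc:
  assumes "Suc j < n"
  shows "convolution_ratio n (Suc j) = convolution_ratio n j *
    ((1 - of_nat n / of_nat (Suc j)) / (1 - 2 * of_nat n / of_nat (2 * Suc j + 1)))"
proof -
  obtain l where l: "n = Suc (Suc j + l)" using assms less_imp_Suc_add by blast
  let ?c = "\<lambda>k. of_nat (central_binomial k) :: rat"
  have c: "?c (Suc k) = 2 * (2 * of_nat k + 1) / (of_nat k + 1) * ?c k" for k
    using central_binomial_Suc_field[of k, where 'a = rat] by (simp add: field_simps)
  have j1: "(of_nat j + 1 :: rat) \<noteq> 0" and l1: "(of_nat l + 1 :: rat) \<noteq> 0"
    and j3: "(2 * of_nat j + 3 :: rat) \<noteq> 0" and l3: "(2 * of_nat l + 1 :: rat) \<noteq> 0"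
    by (simp_all add: add_pos_nonneg less_imp_neq[symmetric] add_nonneg_pos)
  \<comment> \<open>With \<open>n = j + l + 2\<close> both differences are negative, and the signs
    cancel in their quotient.\<close>
  have "(1 - of_nat n / of_nat (Suc j) :: rat) = - ((of_nat l + 1) / (of_nat j + 1))"
    using j1 by (simp add: l field_simps)
  moreover have "(1 - 2 * of_nat n / of_nat (2 * Suc j + 1) :: rat) =
      - ((2 * of_nat l + 1) / (2 * of_nat j + 3))"
    using j3 by (simp add: l field_simps)
  ultimately have g: "(1 - of_nat n / of_nat (Suc j)) /
      (1 - 2 * of_nat n / of_nat (2 * Suc j + 1)) =
      (of_nat l + 1) / (of_nat j + 1) * ((2 * of_nat j + 3) / (2 * of_nat l + 1) :: rat)"
    by (simp only: minus_divide_divide divide_divide_times_eq times_divide_times_eq)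
  have cancel: "A * (2 * B / M * c) * d / X = (B * c * (2 * L / K * d) / X) * (K / M * (A / L))"
    if "K \<noteq> 0" "L \<noteq> 0" for A B M c d X L K :: rat
    using that by (simp add: mult_ac)
  have "convolution_ratio n (Suc j) =
      (2 * of_nat j + 3) * (2 * (2 * of_nat j + 1) / (of_nat j + 1) * ?c j) * ?c l / ?c (n - 1)"
    by (simp add: convolution_ratio_def l c)
  moreover have "convolution_ratio n j =
      (2 * of_nat j + 1) * ?c j * (2 * (2 * of_nat l + 1) / (of_nat l + 1) * ?c l) / ?c (n - 1)"
    by (simp add: convolution_ratio_def l c)
  ultimately show ?thesis
    unfolding g using cancel[OF l1 l3] by (simp only:)
qed

lemma four_times_plus_1_le_power_3: "2 \<le> a \<Longrightarrow> 4 * a + 1 \<le> (3 :: nat) ^ a"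
  by (induction a rule: dec_induct) auto

text \<open>As in \<open>binomial_near_one\<close>, a product of factors near 1, now with the
  denominators \<open>j + 1\<close> and \<open>2 * j + 3\<close>. The range \<open>j < 2 * a\<close>
  ensures that one divides by units only.\<close>

lemma convolution_ratio_near_one:
  assumes n: "3 ^ a dvd n" "n > 0" and a: "2 \<le> a" and "j < 2 * a" "2 * j + 1 < 3 ^ Suc e"
  shows "pow3_dvd a (3 ^ e * (convolution_ratio n j - 1))"
  using assms(4,5)
proof (induction j)
  case 0
  then show ?case by (simp add: convolution_ratio_0)
next
  case (Suc j)
  define x y :: rat where "x = of_nat n / of_nat (Suc j)" and
      "y = 2 * of_nat n / of_nat (2 * Suc j + 1)"
  have n': "pow3_dvd a (of_nat n)" using n(1) by (rule pow3_dvd_of_nat)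
  have Z: "pow3_dvd d (3 ^ e * (c * of_nat n / of_nat i))"
    if "0 < i" "i < 3 ^ Suc e" "d \<le> a" "c \<in> Z3" for i e d c
    using pow3_dvd_mult_left[OF Z3_pow_divide_nat[OF that(1,2)]
        pow3_dvd_mult_left[OF that(4) pow3_dvd_mono[OF n' that(3)]]]
    by (simp add: mult.commute)
  have a': "3 ^ a = (3 :: nat) ^ Suc (a - 1)" using a by (simp flip: power_Suc)
  \<comment> \<open>Hence at most \<open>a - 1\<close> factors 3 are lost, and \<open>x\<close> and
    \<open>y\<close> stay divisible by 3.\<close>
  have lt: "2 * Suc j + 1 < 3 ^ Suc (a - 1)"
    using Suc.prems(1) four_times_plus_1_le_power_3[OF a] unfolding a'[symmetric] by simp
  then have "Suc j < 3 ^ a" unfolding a'[symmetric] by simp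
  then have "Suc j < n" using dvd_imp_le[OF n] by linarith
  have "pow3_dvd a (3 ^ (a - 1) * x)" "pow3_dvd a (3 ^ (a - 1) * y)"
    unfolding x_def y_def using Z[of "Suc j" "a - 1" a 1] Z[of "2 * Suc j + 1" "a - 1" a 2] lt
    by (simp_all del: of_nat_Suc of_nat_add of_nat_mult)
  then have xy: "pow3_dvd 1 x" "pow3_dvd 1 y"
    using pow3_dvd_power_mult_iff[of "a - 1" 1] a by simp_all
  have "pow3_dvd 1 ((1 - y) - of_int 1)" using pow3_dvd_uminus[OF xy(2)] by simp
  note unit = pow3_dvd_divide_unit[OF _ this]
  have "y \<noteq> 1"
  proof
    assume "y = 1"
    then obtain a b :: int where "\<not> 3 dvd b" "b \<noteq> 0" "1 / 3 = (of_int a / of_int b :: rat)"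
      using xy(2) unfolding pow3_dvd_def by (auto elim: Z3_E)
    then have "of_int b = (of_int (3 * a) :: rat)" by (simp add: field_simps)
    then have "b = 3 * a" by (simp only: of_int_eq_iff)
    with \<open>\<not> 3 dvd b\<close> show False by simp
  qed
  have "(1 - x) / (1 - y) \<in> Z3"
    using unit[of 0 "1 - x"] Z3_diff[OF Z3_1 pow3_dvd_imp_Z3[OF xy(1)]]
    by (simp only: pow3_dvd_zero_exponent of_int_1) simp
  then have "pow3_dvd a (3 ^ e * (convolution_ratio n j - 1) * ((1 - x) / (1 - y)))"
    using Suc by (intro pow3_dvd_mult_right[OF _ \<open>(1 - x) / (1 - y) \<in> Z3\<close>]) simp
  moreover have "pow3_dvd a ((3 ^ e * y - 3 ^ e * x) / (1 - y))"
    unfolding x_def y_def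
    using Z[of "Suc j" e a 1] Z[of "2 * Suc j + 1" e a 2] Suc.prems
    by (intro unit[unfolded y_def] pow3_dvd_diff)
        (simp_all del: of_nat_Suc of_nat_add of_nat_mult)
  ultimately have "pow3_dvd a (3 ^ e * (convolution_ratio n j - 1) * ((1 - x) / (1 - y)) +
      (3 ^ e * y - 3 ^ e * x) / (1 - y))"
    by (rule pow3_dvd_add)
  \<comment> \<open>This is \<open>r * s - 1 = (r - 1) * s + (s - 1)\<close> for the old ratio
    \<open>r\<close> and the new factor \<open>s = (1 - x) / (1 - y)\<close>.\<close>
  also have "3 ^ e * (convolution_ratio n j - 1) * ((1 - x) / (1 - y)) +
      (3 ^ e * y - 3 ^ e * x) / (1 - y) =
      3 ^ e * (convolution_ratio n j * ((1 - x) / (1 - y)) - 1)"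
  proof -
    have "(y - x) / (1 - y) = (1 - x) / (1 - y) - 1"
      using \<open>y \<noteq> 1\<close> by (simp add: divide_simps)
    then have "(3 ^ e * y - 3 ^ e * x) / (1 - y) = 3 ^ e * ((1 - x) / (1 - y) - 1)"
      by (metis right_diff_distrib times_divide_eq_right)
    then show ?thesis by (simp only:) (simp only: algebra_simps)
  qed
  also have "convolution_ratio n j * ((1 - x) / (1 - y)) = convolution_ratio n (Suc j)"
    unfolding x_def y_def by (simp only: convolution_ratio_Suc[OF \<open>Suc j < n\<close>])
  finally show ?case .
qed

text \<open>Passing from \<open>3 ^ a\<close> to \<open>2 * a\<close> terms drops only summands
  divisible by \<open>3 ^ a\<close>. The short range is the one covered by
  \<open>convolution_ratio_near_one\<close>.\<close>

lemma truncated_log_short_pow3_dvd: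
  assumes "2 \<le> a"
  shows "pow3_dvd a (\<Sum>j<2 * a. (- 3) ^ j / of_nat (2 * j + 1))"
proof -
  let ?f = "\<lambda>j. (- 3) ^ j / of_nat (2 * j + 1) :: rat"
  have "2 * a \<le> 3 ^ a" using four_times_plus_1_le_power_3[OF assms] by linarith
  then have "sum ?f {..<2 * a} + sum ?f {2 * a..<3 ^ a} = sum ?f {..<3 ^ a}"
    using sum.atLeastLessThan_concat[of 0 "2 * a" "3 ^ a" ?f] by (simp only: atLeast0LessThan)
  then have "sum ?f {..<2 * a} = sum ?f {..<3 ^ a} - sum ?f {2 * a..<3 ^ a}"
    by (simp only: eq_diff_eq)
  also have "pow3_dvd a \<dots>"
  proof (intro pow3_dvd_diff truncated_log_pow3_dvd pow3_dvd_sum)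
    fix j assume j: "j \<in> {2 * a..<3 ^ a}"
    then have "pow3_dvd a (3 ^ j / of_nat (2 * j + 1))"
      using assms by (intro pow3_dvd_mono[OF power_3_divide_odd]) auto
    then have "pow3_dvd a ((- 1) ^ j * (3 ^ j / of_nat (2 * j + 1)))"
      by (intro pow3_dvd_mult_left Z3_power) auto
    then show "pow3_dvd a (?f j)" by (simp add: power_minus[of 3])
  qed auto
  finally show ?thesis .
qed

text \<open>By \<open>central_binomial_pred\<close> a factor \<open>n\<close> splits off, and
  \<open>2 * n - 1\<close> is a unit since \<open>3 dvd n\<close>.\<close>

lemma central_binomial_pred_pow3_dvd:
  assumes "3 ^ a dvd n" "n > 0" "1 \<le> a"
  shows "pow3_dvd a (of_nat (central_binomial (n - 1)))"
proof -
  have "3 dvd n" using assms(1,3) dvd_trans dvd_power[of a 3]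
    by (metis less_le_trans zero_less_one)
  then have "\<not> 3 dvd 2 * (2 * int n - 1)" by presburger
  moreover have "of_int (2 * (2 * int n - 1)) = (2 * (2 * of_nat n - 1) :: rat)" by simp
  ultimately show ?thesis
    unfolding central_binomial_pred[OF assms(2)]
    by (intro pow3_dvd_divide_unit[where c = "2 * (2 * int n - 1)"] pow3_dvd_mult_right
        pow3_dvd_of_nat assms) auto
qed

text \<open>Modulo \<open>3 ^ (2 * a)\<close> the expansion \<open>alternating_mean_eq_sum_central_binomial\<close> at \<open>m = 1\<close>
  reduces to a multiple of the vanishing truncated logarithm, except for the term \<open>j = 1\<close>, the only
  positive \<open>j\<close> for which \<open>3 ^ j / (2 * j + 1)\<close> is a 3-adic unit.\<close>

lemma alternating_mean_1_cong:
  assumes n: "3 ^ a dvd n" "n > 0" and a: "2 \<le> a"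
  shows "pow3_dvd (2 * a) (4 ^ (n - 1) * (of_nat n * alternating_mean n 1) -
     of_nat (central_binomial (n - 1)) * of_nat n / (3 - 2 * of_nat n))"
proof -
  let ?X = "of_nat (central_binomial (n - 1)) :: rat"
  have X: "pow3_dvd a ?X" using a by (intro central_binomial_pred_pow3_dvd n) simp
  \<comment> \<open>The error of replacing the ratio by 1. At \<open>j = 1\<close> this error is
    known exactly and is split off as the exceptional term.\<close>
  define q where "q j = (- 3) ^ j / of_nat (2 * j + 1) * (?X * (convolution_ratio n j - 1)) -
     (if j = 1 then ?X * of_nat n / (3 - 2 * of_nat n) else 0)" for j
  let ?f = "\<lambda>j. of_nat (central_binomial j) * of_nat (central_binomial (n - 1 - j)) *
      (- 3) ^ j :: rat"
  let ?h = "\<lambda>j. (- 3) ^ j / of_nat (2 * j + 1) :: rat"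
  have an: "2 * a < n"
    using four_times_plus_1_le_power_3[OF a] dvd_imp_le[OF n] a by linarith
  have f: "?f j = ?h j * (?X * convolution_ratio n j)" for j
    by (simp add: convolution_ratio_def del: of_nat_add of_nat_mult)
  have split: "sum ?f {..<n} = sum ?f {..<2 * a} + sum ?f {2 * a..<n}"
    using sum.atLeastLessThan_concat[of 0 "2 * a" n ?f] an
    by (simp only: atLeast0LessThan le0 less_imp_le)
  have "?f j = ?X * ?h j + q j + (if j = 1 then ?X * of_nat n / (3 - 2 * of_nat n) else 0)" for j
    unfolding f q_def by (simp add: algebra_simps diff_divide_distrib)
  then have "sum ?f {..<2 * a} =
      ?X * sum ?h {..<2 * a} + sum q {..<2 * a} + ?X * of_nat n / (3 - 2 * of_nat n)"
    using a by (simp add: sum.distrib sum_distrib_left)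
  then have "4 ^ (n - 1) * (of_nat n * alternating_mean n 1) -
      ?X * of_nat n / (3 - 2 * of_nat n) =
      ?X * sum ?h {..<2 * a} + sum q {..<2 * a} + sum ?f {2 * a..<n}"
    using alternating_mean_eq_sum_central_binomial[OF n(2), of 1] split by simp
  also have "pow3_dvd (2 * a) \<dots>"
  proof (intro pow3_dvd_add)
    \<comment> \<open>Half of the exponent comes from \<open>?X\<close>, the other half from the
      logarithm.\<close>
    show "pow3_dvd (2 * a) (?X * sum ?h {..<2 * a})"
      using pow3_dvd_mult[OF X truncated_log_short_pow3_dvd[OF a]] by (simp only: mult_2)
    show "pow3_dvd (2 * a) (sum ?f {2 * a..<n})"
    proof (intro pow3_dvd_sum pow3_dvd_mult_left Z3_mult Z3_of_nat)
      fix j assume "j \<in> {2 * a..<n}"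
      then show "pow3_dvd (2 * a) ((- 3) ^ j)"
        using pow3_dvd_mult_left[of "(- 1) ^ j" j "3 ^ j"]
        by (simp add: power_minus[of 3] pow3_dvd_power Z3_power Z3_uminus pow3_dvd_mono)
    qed
    show "pow3_dvd (2 * a) (sum q {..<2 * a})"
    proof (intro pow3_dvd_sum)
      fix j assume "j \<in> {..<2 * a}"
      then have j: "j < 2 * a" by simp
      consider "j = 0" | "j = 1" | "2 \<le> j" by linarith
      then show "pow3_dvd (2 * a) (q j)"
      proof cases
        case 1
        then show ?thesis by (simp add: q_def convolution_ratio_0)
      next
        case 2
        have n3: "(3 - 2 * of_nat n :: rat) \<noteq> 0" "(2 * of_nat n - 3 :: rat) \<noteq> 0"
        proof -
          have "of_nat (2 * n) \<noteq> (of_nat 3 :: rat)" unfolding of_nat_eq_iff by presburger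
          then show "(3 - 2 * of_nat n :: rat) \<noteq> 0" "(2 * of_nat n - 3 :: rat) \<noteq> 0" by auto
        qed
        have "convolution_ratio n 1 = (1 - of_nat n) / (1 - 2 * of_nat n / 3)"
          using convolution_ratio_Suc[of 0 n] an a by (simp add: convolution_ratio_0)
        also have "\<dots> = 1 - of_nat n / (3 - 2 * of_nat n)"
          using n3 by (simp add: divide_simps)
        finally show ?thesis by (simp add: q_def 2)
      next
        case 3
        have "pow3_dvd a (3 ^ (j div 2) * (convolution_ratio n j - 1))"
          using double_plus_1_less_power_3[OF 3] by (intro convolution_ratio_near_one n a j)
        then have "pow3_dvd a (3 ^ j / of_nat (2 * j + 1) * (convolution_ratio n j - 1))"
          by (rule power_3_divide_odd_mult[OF 3])
        then have "pow3_dvd a ((- 1) ^ j *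
            (3 ^ j / of_nat (2 * j + 1) * (convolution_ratio n j - 1)))"
          by (intro pow3_dvd_mult_left[OF Z3_power]) auto
        from pow3_dvd_mult[OF X this]
        have "pow3_dvd (2 * a) ((- 1) ^ j * 3 ^ j / of_nat (2 * j + 1) *
            (?X * (convolution_ratio n j - 1)))"
          unfolding mult_2 by (simp only: mult_ac times_divide_eq_right times_divide_eq_left)
        then show ?thesis using 3 by (simp add: q_def power_minus[of 3])
      qed
    qed
  qed
  finally show ?thesis .
qed

section \<open>The congruences\<close>

lemma pow3_dvd_third:
  assumes "3 ^ v dvd m - 1" "3 dvd (m - 1 :: int)"
  shows "pow3_dvd (v - 1) (of_int (m - 1) / 3)"
proof (cases v)
  case 0
  then show ?thesis
    using pow3_dvd_divide[of 1 0] pow3_dvd_of_int[of 1 "m - 1"] assms(2)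
    by (simp only: power_one_right) simp
next
  case (Suc u)
  then show ?thesis
    using pow3_dvd_divide[of 1 u] pow3_dvd_of_int[OF assms(1)] by simp
qed

lemma central_mean_pow3_dvd:
  assumes "3 ^ a dvd n" "n > 0" "3 ^ v dvd m - 1" "3 dvd m - 1"
  shows "pow3_dvd (min a (v - 1)) (central_mean n m)"
proof -
  define w :: rat where "w = of_int (m - 1) / 3"
  let ?e = "min a (v - 1)" and ?c = "mean_factor n * of_nat (n - 1)"
  have "pow3_dvd ?e (central_mean n m - central_mean n 1 + ?c * w)"
    unfolding w_def by (rule pow3_dvd_mono[OF central_mean_cong[OF assms(3,4,2)]]) simp
  moreover have "pow3_dvd ?e (central_mean n 1)"
    by (rule pow3_dvd_mono[OF central_mean_1_pow3_dvd[OF assms(1,2)]]) simp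
  moreover have "pow3_dvd ?e w"
    unfolding w_def by (rule pow3_dvd_mono[OF pow3_dvd_third[OF assms(3,4)]]) simp
  then have "pow3_dvd ?e (?c * w)"
    by (rule pow3_dvd_mult_left[OF Z3_mult[OF mean_factor_in_Z3 Z3_of_nat]])
  ultimately have "pow3_dvd ?e ((central_mean n m - central_mean n 1 + ?c * w) +
      central_mean n 1 - ?c * w)"
    by (intro pow3_dvd_diff[OF pow3_dvd_add])
  then show ?thesis by simp
qed

text \<open>Half of the central binomial is \<open>(2 * n - 1) choose (n - 1)\<close>, to which
  \<open>binomial_near_one\<close> applies.\<close>

lemma central_binomial_power_3_cong:
  assumes "1 \<le> a"
  shows "pow3_dvd 1 (of_nat (central_binomial (3 ^ a)) - 2)"
proof -
  define n :: nat where "n = 3 ^ a"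
  have n: "n > 0" "even (n - 1)" by (simp_all add: n_def)
  let ?c = "of_nat ((2 * n - 1) choose (n - 1)) :: rat"
  \<comment> \<open>The role of \<open>n\<close> is taken by \<open>2 * n\<close>. The index
    \<open>n - 1 < 3 ^ a\<close> costs \<open>a - 1\<close> of the \<open>a\<close> factors 3, so
    one remains.\<close>
  have "pow3_dvd a (3 ^ (a - 1) * ((- 1) ^ (n - 1) * ?c - 1))"
    using assms by (intro binomial_near_one) (auto simp: n_def simp flip: power_Suc)
  also have "(- 1) ^ (n - 1) * ?c = ?c" using n(2) by simp
  finally have "pow3_dvd 1 (?c - 1)"
    using pow3_dvd_power_mult_iff[of "a - 1" 1] assms by simp
  then have "pow3_dvd 1 (2 * (?c - 1))" by (rule pow3_dvd_mult_left[OF Z3_numeral])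
  moreover have "n * central_binomial n = n * (2 * ((2 * n - 1) choose (n - 1)))"
    using times_binomial_minus1_eq[of n "2 * n"] n(1) by (simp add: central_binomial_def)
  then have "central_binomial n = 2 * ((2 * n - 1) choose (n - 1))" using n(1) by simp
  ultimately show ?thesis by (simp add: n_def)
qed

lemma pow3_dvd_half: "pow3_dvd e x \<Longrightarrow> pow3_dvd e (x / 2)"
  using Z3_half[of "x / 3 ^ e"] by (simp add: pow3_dvd_def mult.commute)

lemma pow3_dvd_1_power: "1 \<le> a \<Longrightarrow> pow3_dvd 1 (3 ^ a)"
  using pow3_dvd_power pow3_dvd_mono by blast

lemma mean_factor_power_3_cong:
  assumes "1 \<le> a"
  shows "pow3_dvd 1 (mean_factor (3 ^ a) - 1)"
proof -
  let ?N = "3 ^ a - 1 :: nat"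
  have "pow3_dvd 1 (((of_nat (central_binomial (3 ^ a)) - 2) / 2 - (4 ^ ?N - 1)) / 4 ^ ?N)"
    by (intro pow3_dvd_divide_power_4 pow3_dvd_diff[of _ "_ / 2"] pow3_dvd_half
        pow3_dvd_power_4_minus_1
      central_binomial_power_3_cong assms)
  then show ?thesis by (simp add: mean_factor_def diff_divide_distrib)
qed

text \<open>At \<open>n = 3 ^ a\<close> the coefficient \<open>- mean_factor n * (n - 1)\<close> is
  1 modulo 3. This factor 3 makes up for the one lost in \<open>(m - 1) / 3\<close>.\<close>

lemma central_mean_power_3_cong:
  assumes "3 ^ v dvd m - 1" "1 \<le> v" "v \<le> a"
  shows "pow3_dvd v (central_mean (3 ^ a) m - of_int (m - 1) / 3)"
proof -
  define w :: rat where "w = of_int (m - 1) / 3"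
  let ?n = "3 ^ a :: nat"
  have m: "3 dvd m - 1" using assms(1,2)
    by (metis dvd_power dvd_trans less_le_trans zero_less_one)
  have "pow3_dvd 1 (mean_factor ?n * of_nat ?n - (mean_factor ?n - 1))"
    using mean_factor_power_3_cong pow3_dvd_1_power assms
    by (simp add: pow3_dvd_diff pow3_dvd_mult_left mean_factor_in_Z3)
  moreover have "mean_factor ?n * of_nat ?n - (mean_factor ?n - 1) =
      mean_factor ?n * of_nat (?n - 1) + 1"
    by (simp add: of_nat_diff algebra_simps)
  ultimately have "pow3_dvd 1 (mean_factor ?n * of_nat (?n - 1) + 1)" by (simp only:)
  from pow3_dvd_mult[OF this pow3_dvd_third[OF assms(1) m, folded w_def]]
  have "pow3_dvd v ((mean_factor ?n * of_nat (?n - 1) + 1) * w)" using assms(2) by simp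
  moreover have "pow3_dvd v (central_mean ?n m - central_mean ?n 1 +
      mean_factor ?n * of_nat (?n - 1) * w)"
    unfolding w_def by (rule central_mean_cong[OF assms(1) m]) simp
  moreover have "pow3_dvd v (central_mean ?n 1)"
    by (rule pow3_dvd_mono[OF central_mean_1_pow3_dvd[of a] assms(3)]) simp_all
  ultimately have "pow3_dvd v ((central_mean ?n m - central_mean ?n 1 +
      mean_factor ?n * of_nat (?n - 1) * w) + central_mean ?n 1
      - (mean_factor ?n * of_nat (?n - 1) + 1) * w)"
    by (intro pow3_dvd_diff[OF pow3_dvd_add])
  then show ?thesis unfolding w_def[symmetric] by (simp add: algebra_simps)
qed

text \<open>In \<open>alternating_mean_1_cong\<close> the exceptional term is divisible by
  \<open>3 ^ (2 * a - 1)\<close>, and division by \<open>n\<close> leaves \<open>a - 1\<close>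
  factors. For \<open>a \<le> 1\<close> the claim is integrality.\<close>

lemma alternating_mean_1_pow3_dvd:
  assumes "n > 0"
  shows "pow3_dvd (multiplicity 3 n - 1) (alternating_mean n 1)"
proof (cases "multiplicity 3 n \<le> 1")
  case True
  then show ?thesis using alternating_mean_1_in_Z3[OF assms] by simp
next
  case False
  define a where "a = multiplicity 3 n"
  have a: "2 \<le> a" using False by (simp add: a_def)
  have n: "3 ^ a dvd n" by (simp add: a_def multiplicity_dvd)
  let ?X = "of_nat (central_binomial (n - 1)) :: rat" and ?t = "of_nat n / 3 :: rat"
  have t: "pow3_dvd (a - 1) ?t"
    using pow3_dvd_divide[of 1 "a - 1" "of_nat n"] pow3_dvd_of_nat[OF n] a by simp
  have "pow3_dvd 1 ((1 - 2 * ?t) - of_int 1)"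
    using pow3_dvd_uminus[OF pow3_dvd_mult_left[OF Z3_numeral pow3_dvd_mono[OF t, of 1]]] a
    by simp
  then have "pow3_dvd (a - 1) (?t / (1 - 2 * ?t))"
    by (rule pow3_dvd_divide_unit[OF t]) simp
  then have "pow3_dvd (a + (a - 1)) (?X * (?t / (1 - 2 * ?t)))"
    using a by (intro pow3_dvd_mult central_binomial_pred_pow3_dvd n assms) auto
  moreover have "?t / (1 - 2 * ?t) = of_nat n / (3 - 2 * of_nat n)"
  proof -
    have "1 - 2 * ?t = (3 - 2 * of_nat n) / 3" by (simp add: diff_divide_distrib)
    then show ?thesis by simp
  qed
  ultimately have "pow3_dvd (a + (a - 1)) (?X * (of_nat n / (3 - 2 * of_nat n)))" by (simp only:)
  moreover have "pow3_dvd (a + (a - 1)) (4 ^ (n - 1) * (of_nat n * alternating_mean n 1) -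
      ?X * of_nat n / (3 - 2 * of_nat n))"
    by (rule pow3_dvd_mono[OF alternating_mean_1_cong[OF n assms a]]) simp
  ultimately have "pow3_dvd (a + (a - 1)) (4 ^ (n - 1) * (of_nat n * alternating_mean n 1) -
      ?X * of_nat n / (3 - 2 * of_nat n) + ?X * (of_nat n / (3 - 2 * of_nat n)))"
    by (intro pow3_dvd_add)
  then have "pow3_dvd (a + (a - 1)) (4 ^ (n - 1) * (of_nat n * alternating_mean n 1))" by simp
  from pow3_dvd_divide_power_4[OF this, of "n - 1"]
  have "pow3_dvd (a + (a - 1)) (of_nat n * alternating_mean n 1)" by simp
  then have "pow3_dvd (a - 1) (of_nat n * alternating_mean n 1 / of_nat n)"
    unfolding a_def using assms by (rule pow3_dvd_divide_of_nat)
  then show ?thesis using assms by (simp add: a_def)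
qed

text \<open>The factor 3 accounts for the -1 in the bound of (ii) and clears the denominator of
  \<open>(m - 1) / 3\<close>.\<close>

lemma alternating_mean_pow3_dvd:
  assumes "n > 0" "3 ^ v dvd m - 1" "3 dvd m - 1"
  shows "pow3_dvd (min (multiplicity 3 n) v) (3 * alternating_mean n m)"
proof -
  let ?w = "of_int (m - 1) / 3 :: rat" and ?e = "min (multiplicity 3 n) v"
  obtain W where W: "W \<in> Z3" and c:
      "pow3_dvd v (alternating_mean n m - alternating_mean n 1 - W * ?w)"
    using alternating_mean_cong[OF assms(1)] assms(2,3) by metis
  have "pow3_dvd (1 + (multiplicity 3 n - 1)) (3 ^ 1 * alternating_mean n 1)"
    by (intro pow3_dvd_mult pow3_dvd_power alternating_mean_1_pow3_dvd assms)
  then have "pow3_dvd ?e (3 * alternating_mean n 1)"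
    using pow3_dvd_mono[of "1 + (multiplicity 3 n - 1)" "3 * alternating_mean n 1" ?e] by simp
  moreover have "pow3_dvd ?e (W * of_int (m - 1))"
    by (rule pow3_dvd_mono[OF pow3_dvd_mult_left[OF W pow3_dvd_of_int[OF assms(2)]]]) simp
  moreover have "pow3_dvd ?e (3 * (alternating_mean n m - alternating_mean n 1 - W * ?w))"
    by (rule pow3_dvd_mono[OF pow3_dvd_mult_left[OF Z3_numeral c]]) simp
  ultimately have "pow3_dvd ?e (3 * (alternating_mean n m - alternating_mean n 1 - W * ?w) +
      3 * alternating_mean n 1 + W * of_int (m - 1))"
    by (intro pow3_dvd_add)
  then show ?thesis by (simp add: algebra_simps del: of_int_diff)
qed

text \<open>Half the central binomial is 1 and \<open>2 * 3 ^ a - 1\<close> is -1 modulo 3; their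
  quotient is the Catalan number of index \<open>3 ^ a - 1\<close>.\<close>

lemma catalan_power_3_cong:
  assumes "1 \<le> a"
  shows "pow3_dvd 1 (of_nat (central_binomial (3 ^ a)) / 2 / (2 * 3 ^ a - 1) + 1)"
proof -
  let ?c = "of_nat (central_binomial (3 ^ a)) :: rat"
  have n: "pow3_dvd 1 (2 * 3 ^ a)"
    by (intro pow3_dvd_mult_left pow3_dvd_1_power assms) simp
  then have "pow3_dvd 1 ((2 * 3 ^ a - 1) - of_int (- 1))" by simp
  then have "pow3_dvd 1 (((?c - 2) / 2 + 2 * 3 ^ a) / (2 * 3 ^ a - 1))"
    by (intro pow3_dvd_divide_unit[where c = "- 1"] pow3_dvd_add[OF _ n] pow3_dvd_half
      central_binomial_power_3_cong assms) simp_all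
  moreover have "(2 * 3 ^ a - 1 :: rat) \<noteq> 0"
    using one_le_power[of "3 :: rat" a] by linarith
  ultimately show ?thesis by (simp add: field_simps)
qed

text \<open>The coefficient \<open>W\<close> of \<open>alternating_mean_cong\<close> does not depend on \<open>m\<close>, so it can be
  read off at \<open>m = 4\<close>, where the mean is a Catalan number over a power of 4.\<close>

lemma alternating_mean_power_3_cong:
  assumes "3 ^ v dvd m - 1" "1 \<le> v" "v < a"
  shows "pow3_dvd v (alternating_mean (3 ^ a) m + of_int (m - 1) / 3)"
proof -
  define w :: rat where "w = of_int (m - 1) / 3"
  let ?n = "3 ^ a :: nat"
  have m: "3 dvd m - 1" using assms(1,2)
    by (metis dvd_power dvd_trans less_le_trans zero_less_one)
  have "?n > 0" by simp
  then obtain W where W: "\<And>v m. 3 ^ v dvd m - 1 \<Longrightarrow> 3 dvd m - 1 \<Longrightarrow>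
      pow3_dvd v (alternating_mean ?n m - alternating_mean ?n 1 - W * (of_int (m - 1) / 3))"
    by (rule alternating_mean_cong) blast
  \<comment> \<open>The hypothesis \<open>v < a\<close> enters through this exponent.\<close>
  have T1: "pow3_dvd (a - 1) (alternating_mean ?n 1)"
    using alternating_mean_1_pow3_dvd[of ?n] by simp
  let ?z = "of_nat (central_binomial ?n) / 2 / (2 * 3 ^ a - 1) :: rat"
  have "pow3_dvd 1 (?z + 1)" using assms by (intro catalan_power_3_cong) simp
  from pow3_dvd_divide_power_4[OF pow3_dvd_add[OF this pow3_dvd_power_4_minus_1], of "?n - 1"
      "?n - 1"]
  have "pow3_dvd 1 (alternating_mean ?n 4 + 1)"
    by (subst alternating_mean_4) (simp_all add: add_divide_distrib)
  moreover have "pow3_dvd 1 (alternating_mean ?n 1)" using pow3_dvd_mono[OF T1, of 1] assms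
    by simp
  \<comment> \<open>At \<open>m = 4\<close> one has \<open>(m - 1) / 3 = 1\<close>, which determines
    \<open>W\<close> as -1 modulo 3.\<close>
  moreover have "pow3_dvd 1 (alternating_mean ?n 4 - alternating_mean ?n 1 - W)" using W[of 1 4]
    by simp
  ultimately have "pow3_dvd 1 (alternating_mean ?n 4 + 1 - alternating_mean ?n 1 -
      (alternating_mean ?n 4 - alternating_mean ?n 1 - W))"
    by (rule pow3_dvd_diff[OF pow3_dvd_diff])
  then have "pow3_dvd 1 (W + 1)" by (simp add: algebra_simps)
  from pow3_dvd_mult[OF this pow3_dvd_third[OF assms(1) m, folded w_def]]
  have "pow3_dvd v ((W + 1) * w)" using assms(2) by simp
  moreover have "pow3_dvd v (alternating_mean ?n 1)" using pow3_dvd_mono[OF T1, of v] assms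
    by simp
  moreover have "pow3_dvd v (alternating_mean ?n m - alternating_mean ?n 1 - W * w)"
    unfolding w_def using W[OF assms(1) m] .
  ultimately have "pow3_dvd v ((alternating_mean ?n m - alternating_mean ?n 1 - W * w) +
      alternating_mean ?n 1 + (W + 1) * w)"
    by (intro pow3_dvd_add[OF pow3_dvd_add])
  then show ?thesis unfolding w_def[symmetric] by (simp add: algebra_simps)
qed

text \<open>Now the exceptional term counts: it equals \<open>3 ^ a * (t * y)\<close> with
  \<open>t = 3 ^ (a - 1)\<close> and \<open>y\<close> congruent to -1 modulo 3. Division by
  \<open>3 ^ a\<close> leaves \<open>- t\<close> modulo \<open>3 ^ a\<close>.\<close>

lemma alternating_mean_1_power_3_cong:
  assumes "2 \<le> a"
  shows "pow3_dvd a (alternating_mean (3 ^ a) 1 + 3 ^ (a - 1))"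
proof -
  define n :: nat where "n = 3 ^ a"
  \<comment> \<open>\<open>t\<close> is a third of \<open>n\<close> and \<open>z\<close> the Catalan
    number of index \<open>n - 1\<close>.\<close>
  define t z y :: rat where "t = 3 ^ (a - 1)"
    and "z = of_nat (central_binomial n) / 2 / (2 * of_nat n - 1)" and "y = z / (1 - 2 * t)"
  have t: "pow3_dvd (a - 1) t" by (simp add: t_def pow3_dvd_power)
  have nt: "of_nat n = 3 * t" using assms by (simp add: n_def t_def flip: power_Suc)
  have t1: "1 - 2 * t \<noteq> 0" using one_le_power[of "3 :: rat" "a - 1"] unfolding t_def by linarith
  have "pow3_dvd 1 (2 * t)"
    using assms by (intro pow3_dvd_mult_left pow3_dvd_mono[OF t]) auto
  moreover from pow3_dvd_uminus[OF this] have "pow3_dvd 1 ((1 - 2 * t) - of_int 1)" by simp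
  moreover have "pow3_dvd 1 (z + 1)"
    using catalan_power_3_cong[of a] assms by (simp add: z_def n_def)
  ultimately have "pow3_dvd 1 ((z + 1 - 2 * t) / (1 - 2 * t))"
    by (intro pow3_dvd_divide_unit[where c = 1] pow3_dvd_diff[of 1 "z + 1"]) simp_all
  moreover have "(z + 1 - 2 * t) / (1 - 2 * t) = y + 1"
    using t1 by (simp add: y_def field_simps)
  ultimately have "pow3_dvd 1 (y + 1)" by (simp only:)
  from pow3_dvd_mult[OF t this] have y: "pow3_dvd a (t * (y + 1))" using assms by simp
  have "3 - 2 * of_nat n = 3 * (1 - 2 * t)" by (simp add: nt)
  then have "of_nat n / (3 - 2 * of_nat n) = t / (1 - 2 * t)"
    unfolding nt by (metis mult_divide_mult_cancel_left zero_neq_numeral)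
  moreover have "of_nat (central_binomial (n - 1)) = 3 ^ a * z"
    using central_binomial_pred[of n] by (simp add: z_def n_def)
  ultimately have "of_nat (central_binomial (n - 1)) * of_nat n / (3 - 2 * of_nat n) =
      3 ^ a * z * (t / (1 - 2 * t))"
    by (metis times_divide_eq_right)
  then have eq: "of_nat (central_binomial (n - 1)) * of_nat n / (3 - 2 * of_nat n) =
      3 ^ a * (t * y)"
    by (simp add: y_def mult_ac)
  have "pow3_dvd (2 * a) (4 ^ (n - 1) * (of_nat n * alternating_mean n 1) - 3 ^ a * (t * y))"
    unfolding eq[symmetric] by (rule alternating_mean_1_cong) (use assms in \<open>simp_all add: n_def\<close>)
  moreover have "of_nat n = (3 ^ a :: rat)" by (simp add: n_def)
  ultimately have "pow3_dvd (a + a) (3 ^ a * (4 ^ (n - 1) * alternating_mean n 1 - t * y))"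
    by (simp only: mult_2 right_diff_distrib mult.left_commute)
  then have "pow3_dvd a (4 ^ (n - 1) * alternating_mean n 1 - t * y)"
    by (simp only: pow3_dvd_power_mult_iff)
  moreover have "pow3_dvd a (t * (4 ^ (n - 1) - 1))"
    using pow3_dvd_mult[OF t pow3_dvd_power_4_minus_1, of "n - 1"] assms by simp
  ultimately have "pow3_dvd a ((4 ^ (n - 1) * alternating_mean n 1 - t * y) + t * (y + 1) +
      t * (4 ^ (n - 1) - 1))"
    using y by (intro pow3_dvd_add)
  then have "pow3_dvd a (4 ^ (n - 1) * (alternating_mean n 1 + t))" by (simp add: algebra_simps)
  from pow3_dvd_divide_power_4[OF this, of "n - 1"] show ?thesis by (simp add: n_def t_def)
qed

section \<open>Translation into \<open>padic_order\<close>\<close>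

lemma padic_order_3_of_int:
  "k \<noteq> 0 \<Longrightarrow> padic_order 3 (of_int k) = Fin (int (multiplicity 3 k))"
  by (simp add: padic_order_def)

lemma multiplicity_3_of_nat: "multiplicity 3 (int n) = multiplicity 3 n"
proof (cases "n = 0")
  case False
  then obtain q where q: "n = 3 ^ multiplicity 3 n * q" "\<not> 3 dvd q"
    using multiplicity_decompose'[of n 3] by auto
  have "\<not> 3 dvd int q" using q(2) by presburger
  then have "multiplicity 3 (int (3 ^ multiplicity 3 n * q)) = multiplicity 3 n"
    using multiplicity_3_power_mult by simp
  then show ?thesis using q(1) by simp
qed simp

lemma padic_order_3_of_nat:
  "n \<noteq> 0 \<Longrightarrow> padic_order 3 (of_nat n) = Fin (int (multiplicity 3 n))"
  using padic_order_3_of_int[of "int n"] by (simp add: multiplicity_3_of_nat)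

theorem theorem1p1:
  fixes m :: int
  assumes "[m = 1] (mod 3)"
  shows
    "(\<forall>n::nat. n > 0 \<longrightarrow>
       padic_order 3 (1 / of_nat n * (\<Sum>k<n. 1 / of_int m ^ k * of_nat ((2 * k) choose k)))
         \<ge> min (padic_order 3 (of_nat n)) (padic_order 3 (of_int (m - 1)) - 1)) \<and>
     (\<forall>a::nat. Fin (int a) \<ge> padic_order 3 (of_int (m - 1)) \<longrightarrow>
       padic_cong 3 (padic_order 3 (of_int (m - 1)))
         (1 / 3 ^ a * (\<Sum>k<3 ^ a. 1 / of_int m ^ k * of_nat ((2 * k) choose k)))
         (of_int (m - 1) / 3)) \<and>
     (\<forall>n::nat. n > 0 \<longrightarrow>
       padic_order 3 (1 / of_nat n *
           (\<Sum>k<n. (- 1) ^ k / of_int m ^ k * of_nat ((n - 1) choose k) * of_nat ((2 * k) choose k)))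
         \<ge> min (padic_order 3 (of_nat n)) (padic_order 3 (of_int (m - 1))) - 1) \<and>
     (\<forall>a::nat. Fin (int a) > padic_order 3 (of_int (m - 1)) \<longrightarrow>
       padic_cong 3 (padic_order 3 (of_int (m - 1)))
         (1 / 3 ^ a *
           (\<Sum>k<3 ^ a. (- 1) ^ k / of_int m ^ k * of_nat ((3 ^ a - 1) choose k) * of_nat ((2 * k) choose k)))
         (- (of_int (m - 1) / 3))) \<and>
     (\<forall>a::nat. a \<ge> 2 \<longrightarrow>
       padic_cong 3 (Fin (int a))
         (1 / 3 ^ a *
           (\<Sum>k<3 ^ a. (- 1) ^ k * of_nat ((3 ^ a - 1) choose k) * of_nat ((2 * k) choose k)))
         (- (3 ^ (a - 1))))"
proof -
  have m: "3 dvd m - 1" using assms by (simp add: cong_iff_dvd_diff)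
  have central_mean_eq: "1 / of_nat n * (\<Sum>k<n. 1 / of_int m ^ k * of_nat ((2 * k) choose k)) =
      central_mean n m" for n
    by (simp add: central_mean_def central_binomial_def)
  have central_mean_eq3: "1 / 3 ^ a * (\<Sum>k<3 ^ a. 1 / of_int m ^ k * of_nat ((2 * k) choose k)) =
      central_mean (3 ^ a) m" for a
    using central_mean_eq[of "3 ^ a"] by simp
  have alternating_mean_eq: "1 / of_nat n *
      (\<Sum>k<n. (- 1) ^ k / of_int m ^ k * of_nat ((n - 1) choose k) *
      of_nat ((2 * k) choose k)) = alternating_mean n m" for n m
    by (simp add: alternating_mean_def central_binomial_def)
  have alternating_mean_eq3: "1 / 3 ^ a *
      (\<Sum>k<3 ^ a. (- 1) ^ k / of_int m ^ k * of_nat ((3 ^ a - 1) choose k) *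
      of_nat ((2 * k) choose k)) = alternating_mean (3 ^ a) m" for a m
    using alternating_mean_eq[of "3 ^ a"] by simp
  have alternating_mean_eq31: "1 / 3 ^ a * (\<Sum>k<3 ^ a. (- 1) ^ k * of_nat ((3 ^ a - 1) choose k) *
      of_nat ((2 * k) choose k)) = alternating_mean (3 ^ a) 1" for a
    using alternating_mean_eq3[where m = 1] by simp
  have ge: "Fin (int e) \<le> padic_order 3 x \<longleftrightarrow> pow3_dvd e x" for e x
    using padic_order_3_ge_iff[of e 0] by simp
  have ge1: "Fin (int e - 1) \<le> padic_order 3 x \<longleftrightarrow> pow3_dvd e (3 * x)" for e x
    using padic_order_3_ge_iff[of e 1] by simp
  show ?thesis unfolding central_mean_eq central_mean_eq3 alternating_mean_eq
      alternating_mean_eq3 alternating_mean_eq31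
  proof (intro conjI allI impI)
    fix n :: nat assume n: "n > 0"
    note n_order = padic_order_3_of_nat[OF n[THEN less_imp_neq, symmetric]]
    let ?a = "multiplicity 3 n"
    show "min (padic_order 3 (of_nat n)) (padic_order 3 (of_int (m - 1)) - 1) \<le>
        padic_order 3 (central_mean n m)"
    proof (cases "m = 1")
      \<comment> \<open>The order of \<open>m - 1\<close> is infinite, so the minimum is the order
        of \<open>n\<close>.\<close>
      case True
      then show ?thesis
        using central_mean_1_pow3_dvd[OF multiplicity_dvd n] unfolding n_order
        by (simp add: padic_order_def[of _ 0] ge one_extended_def)
    next
      case False
      let ?v = "multiplicity 3 (m - 1)"
      \<comment> \<open>Ensures that \<open>?v - 1\<close> is the same in the naturals and in the
        integers.\<close>
      have v: "1 \<le> ?v" using False m by (intro multiplicity_geI) auto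
      have "min (padic_order 3 (of_nat n)) (padic_order 3 (of_int (m - 1)) - 1) =
          Fin (int (min ?a (?v - 1)))"
        using False v by (simp add: n_order padic_order_3_of_int one_extended_def min_def del:
            of_int_diff) linarith
      then show ?thesis using central_mean_pow3_dvd[OF multiplicity_dvd n multiplicity_dvd m]
        by (simp only: ge)
    qed
    show "min (padic_order 3 (of_nat n)) (padic_order 3 (of_int (m - 1))) - 1 \<le>
        padic_order 3 (alternating_mean n m)"
    proof (cases "m = 1")
      \<comment> \<open>Every power of 3 divides \<open>m - 1 = 0\<close>, so \<open>v\<close> can
        be taken as the order of \<open>n\<close>.\<close>
      case True
      then show ?thesis
        using alternating_mean_pow3_dvd[OF n, of ?a 1] unfolding n_order
        by (simp add: padic_order_def[of _ 0] ge1 one_extended_def)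
    next
      case False
      let ?v = "multiplicity 3 (m - 1)"
      have "min (padic_order 3 (of_nat n)) (padic_order 3 (of_int (m - 1))) - 1 =
          Fin (int (min ?a ?v) - 1)"
        using False by (simp add: n_order padic_order_3_of_int one_extended_def min_def del:
            of_int_diff)
      then show ?thesis using alternating_mean_pow3_dvd[OF n multiplicity_dvd m]
        by (simp only: ge1)
    qed
  next
    fix a :: nat assume a: "padic_order 3 (of_int (m - 1)) \<le> Fin (int a)"
    \<comment> \<open>At \<open>m = 1\<close> the order is infinite and no \<open>a\<close> bounds
      it.\<close>
    then have "m \<noteq> 1" by (auto simp: padic_order_def)
    then have v: "padic_order 3 (of_int (m - 1)) = Fin (int (multiplicity 3 (m - 1)))"
      by (intro padic_order_3_of_int) simp
    have "1 \<le> multiplicity 3 (m - 1)" using \<open>m \<noteq> 1\<close> m by (intro multiplicity_geI) auto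
    then show "padic_cong 3 (padic_order 3 (of_int (m - 1))) (central_mean (3 ^ a) m)
        (of_int (m - 1) / 3)"
      using a unfolding v padic_cong_def ge
      by (intro central_mean_power_3_cong multiplicity_dvd) auto
  next
    fix a :: nat assume a: "padic_order 3 (of_int (m - 1)) < Fin (int a)"
    then have "m \<noteq> 1" by (auto simp: padic_order_def)
    then have v: "padic_order 3 (of_int (m - 1)) = Fin (int (multiplicity 3 (m - 1)))"
      by (intro padic_order_3_of_int) simp
    have "1 \<le> multiplicity 3 (m - 1)" using \<open>m \<noteq> 1\<close> m by (intro multiplicity_geI) auto
    then show "padic_cong 3 (padic_order 3 (of_int (m - 1))) (alternating_mean (3 ^ a) m)
        (- (of_int (m - 1) / 3))"
      using a unfolding v padic_cong_def ge diff_minus_eq_add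
      by (intro alternating_mean_power_3_cong multiplicity_dvd) auto
  next
    fix a :: nat assume "2 \<le> a"
    then show "padic_cong 3 (Fin (int a)) (alternating_mean (3 ^ a) 1) (- (3 ^ (a - 1)))"
      unfolding padic_cong_def ge diff_minus_eq_add by (rule alternating_mean_1_power_3_cong)
  qed
qed

end
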